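(* If the heat conduction network diffusion is asymptotically strong Feller at the equilibrium point $c_0$ and the stability condition is satisfied, then the diffusion has at most one invariant probability measure.
   Context: Let $G=(\mathcal{V},\sim)$ be a finite connected graph with $N=|\mathcal{V}|$ vertices and let $n=2N$. Let $\mathcal{D}\subset\mathcal{V}$ be a non-empty subset (damped set) and $\partial\mathcal{V}\subset\mathcal{D}$ a non-empty subset (boundary set), with temperatures $T_i>0$ for $i\in\partial\mathcal{V}$. Each vertex $i$ has position $q_i\in\mathbb{R}$ and momentum $p_i\in\mathbb{R}$. The pinning potential $V:\mathbb{R}\to\mathbb{R}$ and the interaction potential $U:\mathbb{R}\to\mathbb{R}$ are convex polynomial functions. The Hamiltonian is $$H(q,p)=\sum_{i\in\mathcal{V}}\Big(\tfrac12p_i^2+V(q_i)+\tfrac12\sum_{j\sim i}U(q_i-q_j)\Big),$$ and it is assumed that $H$ has a unique minimizer $c_0\in\mathbb{R}^n$, called the equilibrium point, normalized (by adding a constant) so that $H(c_0)=0$. The heat conduction network is the diffusion $Z=(q,p)\in\mathbb{R}^n$ solving, for $i\in\mathcal{V}$, $$dq_i=p_i\,dt,\qquad dp_i=-\partial_{q_i}H\,dt-p_i\mathbf{1}_{i\in\mathcal{D}}\,dt+\sqrt{2T_i}\,\mathbf{1}_{i\in\partial\mathcal{V}}\,dB_i,$$ with $(B_i)_{i\in\partial\mathcal{V}}$ independent Brownian motions. Let $(P_t)$ be its semigroup; a probability measure $\mu$ on $\mathbb{R}^n$ is invariant if $P_t^\star\mu=\mu$ for all $t\ge0$, where $P_t^\star\mu(A)=\int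 P_t(z,A)\,\mu(dz)$. Stability condition: the only solution $z_t=(q(t),p(t))$ of the deterministic system $$\dot q_i=p_i,\qquad \dot p_i=-\partial_{q_i}H,\qquad p_i\mathbf{1}_{i\in\mathcal{D}}\equiv0\qquad(i\in\mathcal{V})$$ is $z_t\equiv c_0$. Asymptotic strong Feller property: an increasing sequence $(d_m)$ of (continuous) pseudo-metrics on $\mathbb{R}^n$ is a totally separating system if $d_m(x,y)\to1$ for all $x\ne y$. For a pseudo-metric $d$ and probability measures $\mu,\nu$, $\|\mu-\nu\|_d=\inf_\Gamma\int d(x,y)\,\Gamma(dx,dy)$, the infimum being over all couplings $\Gamma$ of $(\mu,\nu)$. The semigroup $(P_t)$ (or the diffusion) is asymptotically strong Feller at $z\in\mathbb{R}^n$ if there exist a totally separating system $(d_m)$ and a sequence $t_m>0$ such that $$\lim_{\gamma\to0}\limsup_{m\to\infty}\sup_{y\in B(z,\gamma)}\|P_{t_m}(z,\cdot)-P_{t_m}(y,\cdot)\|_{d_m}=0,$$ where $B(z,\gamma)$ is the ball of radius $\gamma$ centred at $z$. *)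

theory Defs
  imports "HOL-Probability.Probability" "HOL-Computational_Algebra.Polynomial"
begin

section \<open>Graphs and Hamiltonian\<close>

text \<open>The vertex set is the whole of a finite type \<open>'v\<close>; the phase space is the product of
  the positions and the momenta, whose product norm is the Euclidean one.\<close>

type_synonym 'v state = "(real ^ 'v) \<times> (real ^ 'v)"

abbreviation pos :: "'v::finite state \<Rightarrow> 'v \<Rightarrow> real" where
  "pos z i \<equiv> fst z $ i"

abbreviation mom :: "'v::finite state \<Rightarrow> 'v \<Rightarrow> real" where
  "mom z i \<equiv> snd z $ i"

definition connected_graph :: "('v \<Rightarrow> 'v \<Rightarrow> bool) \<Rightarrow> bool" where
  "connected_graph E \<longleftrightarrow> symp E \<and> irreflp E \<and> (\<forall>i j. E\<^sup>*\<^sup>* i j)"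

definition hamiltonian ::
    "('v::finite \<Rightarrow> 'v \<Rightarrow> bool) \<Rightarrow> real poly \<Rightarrow> real poly \<Rightarrow> 'v state \<Rightarrow> real" where
  "hamiltonian E V U z =
     (\<Sum>i\<in>UNIV. (mom z i)\<^sup>2 / 2 + poly V (pos z i)
        + (\<Sum>j | E j i. poly U (pos z i - pos z j)) / 2)"

definition partial_q :: "'v::finite \<Rightarrow> ('v state \<Rightarrow> real) \<Rightarrow> 'v state \<Rightarrow> real" where
  "partial_q i F z = deriv (\<lambda>x. F ((\<chi> j. if j = i then x else pos z j), snd z)) (pos z i)"

definition stability_condition :: "('v::finite state \<Rightarrow> real) \<Rightarrow> 'v set \<Rightarrow> 'v state \<Rightarrow> bool" where
  "stability_condition H D c \<longleftrightarrow>
     (\<forall>z :: real \<Rightarrow> 'v state.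
        (\<forall>t\<ge>0. \<forall>i.
            ((\<lambda>s. pos (z s) i) has_real_derivative mom (z t) i) (at t within {0..}) \<and>
            ((\<lambda>s. mom (z s) i) has_real_derivative - partial_q i H (z t)) (at t within {0..}) \<and>
            (i \<in> D \<longrightarrow> mom (z t) i = 0))
        \<longrightarrow> (\<forall>t\<ge>0. z t = c))"


section \<open>The diffusion\<close>

definition brownian_motion :: "'w measure \<Rightarrow> (real \<Rightarrow> 'w \<Rightarrow> real) \<Rightarrow> bool" where
  "brownian_motion M B \<longleftrightarrow>
     (\<forall>t\<ge>0. B t \<in> borel_measurable M) \<and>
     (AE w in M. B 0 w = 0) \<and>
     (AE w in M. continuous_on {0..} (\<lambda>t. B t w)) \<and>
     (\<forall>s t. 0 \<le> s \<and> s < t \<longrightarrow>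
        distributed M lborel (\<lambda>w. B t w - B s w) (\<lambda>x. ennreal (normal_density 0 (sqrt (t - s)) x))) \<and>
     (\<forall>(\<tau> :: nat \<Rightarrow> real) k. 0 \<le> \<tau> 0 \<and> mono \<tau> \<longrightarrow>
        prob_space.indep_vars M (\<lambda>_. borel) (\<lambda>j w. B (\<tau> (Suc j)) w - B (\<tau> j) w) {..<k})"

definition independent_brownian_motions ::
    "'w measure \<Rightarrow> 'i set \<Rightarrow> ('i \<Rightarrow> real \<Rightarrow> 'w \<Rightarrow> real) \<Rightarrow> bool" where
  "independent_brownian_motions M I B \<longleftrightarrow>
     (\<forall>i\<in>I. brownian_motion M (B i)) \<and>
     prob_space.indep_vars M (\<lambda>_. Pi\<^sub>M {0..} (\<lambda>_. borel)) (\<lambda>i w. \<lambda>t\<in>{0..}. B i t w) I"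

text \<open>The noise is additive, so the stochastic integral of the constant \<open>sqrt (2 T i)\<close> is
  \<open>sqrt (2 T i) * B i t\<close> and the equation is a pathwise integral equation. The process \<open>Z z\<close> is
  the solution started at \<open>z\<close>.\<close>

definition heat_network_solution ::
    "'w measure \<Rightarrow> ('v::finite state \<Rightarrow> real) \<Rightarrow> 'v set \<Rightarrow> 'v set \<Rightarrow> ('v \<Rightarrow> real)
      \<Rightarrow> ('v \<Rightarrow> real \<Rightarrow> 'w \<Rightarrow> real) \<Rightarrow> ('v state \<Rightarrow> real \<Rightarrow> 'w \<Rightarrow> 'v state) \<Rightarrow> bool" where
  "heat_network_solution M H D bd T B Z \<longleftrightarrow>
     (\<forall>z. (\<forall>t\<ge>0. Z z t \<in> borel_measurable M) \<and>
       (AE w in M. continuous_on {0..} (\<lambda>t. Z z t w) \<and>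
         (\<forall>t\<ge>0. \<forall>i.
            ((\<lambda>s. mom (Z z s w) i) has_integral (pos (Z z t w) i - pos z i)) {0..t} \<and>
            ((\<lambda>s. - partial_q i H (Z z s w) - (if i \<in> D then mom (Z z s w) i else 0)) has_integral
               (mom (Z z t w) i - mom z i - (if i \<in> bd then sqrt (2 * T i) * B i t w else 0))) {0..t})))"

definition transition ::
    "'w measure \<Rightarrow> ('a::topological_space \<Rightarrow> real \<Rightarrow> 'w \<Rightarrow> 'a) \<Rightarrow> real \<Rightarrow> 'a \<Rightarrow> 'a measure" where
  "transition M Z t z = distr M borel (Z z t)"

definition invariant_probability ::
    "(real \<Rightarrow> 'a::topological_space \<Rightarrow> 'a measure) \<Rightarrow> 'a measure \<Rightarrow> bool" where
  "invariant_probability P \<mu> \<longleftrightarrow> prob_space \<mu> \<and> sets \<mu> = sets borel \<and>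
     (\<forall>t\<ge>0. \<forall>A\<in>sets borel. (\<integral>\<^sup>+ z. emeasure (P t z) A \<partial>\<mu>) = emeasure \<mu> A)"


section \<open>Asymptotic strong Feller property\<close>

definition pseudo_metric :: "('a \<Rightarrow> 'a \<Rightarrow> real) \<Rightarrow> bool" where
  "pseudo_metric d \<longleftrightarrow>
     (\<forall>x y. 0 \<le> d x y) \<and> (\<forall>x. d x x = 0) \<and> (\<forall>x y. d x y = d y x) \<and>
     (\<forall>x y z. d x z \<le> d x y + d y z)"

definition totally_separating_system :: "(nat \<Rightarrow> 'a::metric_space \<Rightarrow> 'a \<Rightarrow> real) \<Rightarrow> bool" where
  "totally_separating_system d \<longleftrightarrow>
     (\<forall>m. pseudo_metric (d m) \<and> continuous_on UNIV (\<lambda>(x, y). d m x y)) \<and>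
     (\<forall>x y. incseq (\<lambda>m. d m x y)) \<and>
     (\<forall>x y. x \<noteq> y \<longrightarrow> (\<lambda>m. d m x y) \<longlonglongrightarrow> 1)"

definition couplings :: "'a::topological_space measure \<Rightarrow> 'a measure \<Rightarrow> ('a \<times> 'a) measure set" where
  "couplings \<mu> \<nu> = {\<Gamma>. prob_space \<Gamma> \<and> sets \<Gamma> = sets (borel \<Otimes>\<^sub>M borel) \<and>
                      distr \<Gamma> borel fst = \<mu> \<and> distr \<Gamma> borel snd = \<nu>}"

definition coupling_dist ::
    "('a::topological_space \<Rightarrow> 'a \<Rightarrow> real) \<Rightarrow> 'a measure \<Rightarrow> 'a measure \<Rightarrow> ennreal" where
  "coupling_dist d \<mu> \<nu> = (INF \<Gamma>\<in>couplings \<mu> \<nu>. \<integral>\<^sup>+ (x, y). ennreal (d x y) \<partial>\<Gamma>)"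

definition asymptotically_strong_Feller_at ::
    "(real \<Rightarrow> 'a::{metric_space, second_countable_topology} \<Rightarrow> 'a measure) \<Rightarrow> 'a \<Rightarrow> bool" where
  "asymptotically_strong_Feller_at P z \<longleftrightarrow>
     (\<exists>d t. totally_separating_system d \<and> (\<forall>m::nat. 0 < t m) \<and>
        ((\<lambda>\<gamma>. limsup (\<lambda>m. SUP y\<in>ball z \<gamma>. coupling_dist (d m) (P (t m) z) (P (t m) y)))
           \<longlongrightarrow> 0) (at_right 0))"

end

(* Two distinct invariant probabilities have mutually singular invariant Jordan parts. The asymptotic
   strong Feller property at the equilibrium forbids that both parts charge every neighbourhood of the
   equilibrium, while the stability condition puts the equilibrium into the support of every nonzero
   invariant measure: the support is closed and, small noise having positive probability, preserved by
   the damped deterministic flow; a point of it with least energy dissipates nothing, hence is the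
   equilibrium. *)

theory Submission
  imports Defs
begin

section \<open>Perturbed ordinary differential equations\<close>

text \<open>Since the noise is additive, each outcome yields a forced ordinary differential
  equation, and no stochastic calculus enters: a path minus its forcing is differentiable, and all
  energy estimates are made outcome by outcome. The drift is only locally Lipschitz; the missing
  bounds come from \<open>H\<close>, whose sublevel sets are bounded because it is convex with a
  single minimizer. The same boundedness provides the point of least energy in the support. The
  damped flow is not taken from an existence theorem: it is built as the limit of paths inside the
  support, over growing time intervals and with vanishing forcing. Such a path exists because
  staying in the support is almost sure while small noise has positive probability; the latter is
  derived from the independent Gaussian increments alone, by separability and symmetrization. The
  Jordan parts are invariant because a kernel that preserves mass cannot increase a finite measure
  on every set unless it leaves it unchanged. Singularity contradicts the Feller property through a
  single test function, chosen after compact sets that carry most of each part.\<close>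

lemma gronwall:
  fixes u :: "real \<Rightarrow> real"
  assumes u: "continuous_on {0..T} u" and L: "0 \<le> L"
    and le: "\<And>t. t \<in> {0..T} \<Longrightarrow> u t \<le> a + L * integral {0..t} u"
    and t: "t \<in> {0..T}"
  shows "u t \<le> a * exp (L * t)"
proof -
  \<comment> \<open>The right-hand side of the hypothesis times the integrating factor; the
    hypothesis says exactly that its derivative is nonpositive.\<close>
  define v where "v s = (a + L * integral {0..s} u) * exp (- L * s)" for s
  define v' where "v' s = (L * u s) * exp (- L * s) + (a + L * integral {0..s} u) * (exp (- L * s) * (- L))" for s
  have d: "(v has_real_derivative v' s) (at s within {0..t})" if s: "s \<in> {0..t}" for s
  proof -
    have "continuous_on {0..t} u" using continuous_on_subset[OF u] t by auto
    from integral_has_real_derivative[OF this s] show ?thesis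
      unfolding v_def[abs_def] v'_def by (auto intro!: derivative_eq_intros)
  qed
  have v': "v' s \<le> 0" if "s \<in> {0..t}" for s
  proof -
    have "v' s = L * (u s - (a + L * integral {0..s} u)) * exp (- L * s)"
      by (simp add: v'_def algebra_simps)
    also have "\<dots> \<le> 0"
      using le[of s] L t that by (intro mult_nonpos_nonneg mult_nonneg_nonpos) auto
    finally show ?thesis .
  qed
  obtain r where r: "r \<in> {0..t}" "v t - v 0 = v' r * (t - 0)"
    using mvt_very_simple[of 0 t v "\<lambda>x y. v' x * y"] d t by (auto simp: has_field_derivative_def)
  with v'[OF r(1)] t have "v t \<le> v 0" using mult_nonpos_nonneg[of "v' r" t] by auto
  then have "v t \<le> a" by (simp add: v_def)
  then have "(a + L * integral {0..t} u) * exp (- L * t) * exp (L * t) \<le> a * exp (L * t)"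
    unfolding v_def by (intro mult_right_mono) auto
  also have "(a + L * integral {0..t} u) * exp (- L * t) * exp (L * t) = a + L * integral {0..t} u"
    by (simp add: mult.assoc flip: exp_add)
  finally show ?thesis using le[OF t] by linarith
qed

text \<open>At the first time where \<open>u\<close> reaches \<open>c\<close>, the bound holds on
  the whole past, so \<open>step\<close> excludes this time. This is the bootstrap for estimates
  that are valid only while a path stays in a ball, and that then show that it never leaves.\<close>

lemma continuous_barrier:
  fixes u :: "real \<Rightarrow> real"
  assumes u: "continuous_on {0..T} u" and 0: "u 0 \<le> c"
    and step: "\<And>t. t \<in> {0..T} \<Longrightarrow> (\<And>s. s \<in> {0..t} \<Longrightarrow> u s \<le> c) \<Longrightarrow> u t < c"
    and t: "t \<in> {0..T}"
  shows "u t < c"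
proof (rule ccontr)
  assume "\<not> u t < c"
  then have ge: "c \<le> u t" by simp
  define A where "A = {s \<in> {0..t}. u s = c}"
  have ut: "continuous_on {0..t} u" using continuous_on_subset[OF u] t by auto
  have ne: "A \<noteq> {}"
    using IVT'[OF 0 ge _ ut] t by (auto simp: A_def)
  have "closed A"
    unfolding A_def using continuous_closed_preimage_constant[OF ut, of c] by simp
  moreover have "{0..t} \<inter> A = A" by (auto simp: A_def)
  ultimately have "compact A" using compact_Int_closed[of "{0..t}" A] by simp
  then obtain s where s: "s \<in> A" "\<And>r. r \<in> A \<Longrightarrow> s \<le> r"
    using compact_attains_inf ne by metis
  \<comment> \<open>A value above \<open>c\<close> before \<open>s\<close> would, by the
    intermediate value theorem, produce a hit earlier than the first one.\<close>
  have "u r \<le> c" if r: "r \<in> {0..s}" for r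
  proof (rule ccontr)
    assume *: "\<not> u r \<le> c"
    have "continuous_on {0..r} u" using r s(1) t by (intro continuous_on_subset[OF u]) (auto simp: A_def)
    then obtain q where q: "0 \<le> q" "q \<le> r" "u q = c"
      using IVT'[of u 0 c r] 0 * r by auto
    then have "q \<in> A" using r s(1) by (auto simp: A_def)
    with s(2) q r have "q = r" by force
    with q * show False by simp
  qed
  then have "u s < c" using s(1) t by (intro step) (auto simp: A_def)
  with s(1) show False by (simp add: A_def)
qed

text \<open>The integrated form of x' = F(x) + W'. Only the values of \<open>W\<close> occur, so a
  nowhere differentiable Brownian path is admissible as forcing.\<close>

definition forced_solution :: "('a::euclidean_space \<Rightarrow> 'a) \<Rightarrow> 'a \<Rightarrow> (real \<Rightarrow> 'a) \<Rightarrow> real \<Rightarrow> (real \<Rightarrow> 'a) \<Rightarrow> bool" where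
  "forced_solution F z W T x \<longleftrightarrow> continuous_on {0..T} x \<and>
     (\<forall>t\<in>{0..T}. ((\<lambda>s. F (x s)) has_integral (x t - z - W t)) {0..t})"

text \<open>Balls about the origin are used, rather than neighbourhoods of points, because the a
  priori bounds below are bounds on the norm.\<close>

definition locally_Lipschitz :: "('a::real_normed_vector \<Rightarrow> 'b::real_normed_vector) \<Rightarrow> bool" where
  "locally_Lipschitz F \<longleftrightarrow> (\<forall>R. \<exists>L. L-lipschitz_on (cball 0 R) F)"

lemma locally_LipschitzE:
  assumes "locally_Lipschitz F"
  obtains L where "L-lipschitz_on (cball 0 R) F" "0 \<le> L"
  using assms lipschitz_on_nonneg unfolding locally_Lipschitz_def by blast

lemma locally_Lipschitz_continuous:
  assumes "locally_Lipschitz F" shows "continuous_on S F"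
proof -
  have "isCont F x" for x
  proof -
    obtain L where "L-lipschitz_on (cball 0 (norm x + 1)) F" using assms locally_LipschitzE by blast
    then have "continuous_on (ball 0 (norm x + 1)) F"
      using lipschitz_on_continuous_on continuous_on_subset ball_subset_cball by blast
    then show ?thesis by (simp add: continuous_on_eq_continuous_at)
  qed
  then show ?thesis by (simp add: continuous_at_imp_continuous_on)
qed

lemma forced_solution_subset:
  "forced_solution F z W T x \<Longrightarrow> t \<le> T \<Longrightarrow> forced_solution F z W t x"
  unfolding forced_solution_def by (auto elim: continuous_on_subset)

lemma forced_solution_0:
  assumes "forced_solution F z W T x" "0 \<le> T" shows "x 0 = z + W 0"
proof -
  have "((\<lambda>s. F (x s)) has_integral (x 0 - z - W 0)) {0..0}"
    using assms unfolding forced_solution_def by (metis atLeastAtMost_iff order_refl)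
  moreover have "((\<lambda>s. F (x s)) has_integral 0) {0..0}"
    using has_integral_refl(2)[of "\<lambda>s. F (x s)" 0] by simp
  ultimately have "x 0 - z - W 0 = 0" by (rule has_integral_unique)
  then show ?thesis by (simp add: algebra_simps)
qed

text \<open>The differences of the initial points and of the forcings enter the integral equation in
  the same way, as an additive error, so Gronwall applies with the constant
  \<open>a + b\<close>.\<close>

lemma forced_solutions_close:
  fixes F :: "'a::euclidean_space \<Rightarrow> 'a"
  assumes x: "forced_solution F z W T x" and y: "forced_solution F z' W' T y"
    and K: "\<And>t. t \<in> {0..T} \<Longrightarrow> x t \<in> K \<and> y t \<in> K" and F: "L-lipschitz_on K F"
    and z: "norm (z - z') \<le> a" and W: "\<And>t. t \<in> {0..T} \<Longrightarrow> norm (W t - W' t) \<le> b"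
    and t: "t \<in> {0..T}"
  shows "dist (x t) (y t) \<le> (a + b) * exp (L * t)"
proof -
  have L: "0 \<le> L" using F by (rule lipschitz_on_nonneg)
  have cont: "continuous_on {0..T} x" "continuous_on {0..T} y" using x y by (auto simp: forced_solution_def)
  have d: "continuous_on {0..T} (\<lambda>s. dist (x s) (y s))"
    using cont by (intro continuous_intros)
  show ?thesis
  proof (rule gronwall[OF d L _ t])
    fix r assume r: "r \<in> {0..T}"
    have i: "((\<lambda>s. F (x s) - F (y s)) has_integral (x r - z - W r) - (y r - z' - W' r)) {0..r}"
      using x y r by (intro has_integral_diff) (auto simp: forced_solution_def)
    have int: "(\<lambda>s. dist (x s) (y s)) integrable_on {0..r}"
      using r by (intro integrable_continuous_real continuous_on_subset[OF d]) auto
    have "norm ((x r - z - W r) - (y r - z' - W' r)) = norm (integral {0..r} (\<lambda>s. F (x s) - F (y s)))"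
      using i by (simp add: integral_unique)
    also have "\<dots> \<le> integral {0..r} (\<lambda>s. L * dist (x s) (y s))"
    proof (rule integral_norm_bound_integral)
      show "(\<lambda>s. F (x s) - F (y s)) integrable_on {0..r}" using i by blast
      show "(\<lambda>s. L * dist (x s) (y s)) integrable_on {0..r}"
        using int by (rule integrable_on_mult_right)
      fix s assume "s \<in> {0..r}"
      then show "norm (F (x s) - F (y s)) \<le> L * dist (x s) (y s)"
        using lipschitz_onD[OF F] K[of s] r by (auto simp: dist_norm)
    qed
    also have "\<dots> = L * integral {0..r} (\<lambda>s. dist (x s) (y s))" by simp
    finally have "norm ((x r - y r) - ((z - z') + (W r - W' r))) \<le> L * integral {0..r} (\<lambda>s. dist (x s) (y s))"
      by (simp add: algebra_simps)
    moreover have "norm (x r - y r) \<le> norm ((x r - y r) - ((z - z') + (W r - W' r))) + norm (z - z') + norm (W r - W' r)"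
      by (smt (verit) norm_triangle_ineq norm_triangle_sub)
    ultimately show "dist (x r) (y r) \<le> (a + b) + L * integral {0..r} (\<lambda>s. dist (x s) (y s))"
      using z W[OF r] by (simp add: dist_norm)
  qed
qed

text \<open>Continuous dependence on the initial point for one fixed forcing; it makes the
  transition kernels Feller. The Lipschitz constant is only available near \<open>x\<close>, so
  \<open>y k\<close> must first be confined to the unit tube around \<open>x\<close>.\<close>

lemma forced_solution_tendsto:
  fixes F :: "'a::euclidean_space \<Rightarrow> 'a"
  assumes F: "locally_Lipschitz F" and x: "forced_solution F z W T x" and T: "0 \<le> T"
    and y: "\<And>k. forced_solution F (\<zeta> k) W T (y k)" and \<zeta>: "\<zeta> \<longlonglongrightarrow> z"
  shows "(\<lambda>k. y k T) \<longlonglongrightarrow> x T"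
proof -
  have xc: "continuous_on {0..T} x" using x by (simp add: forced_solution_def)
  have "bounded (x ` {0..T})"
    using compact_continuous_image[OF xc] by (intro compact_imp_bounded) auto
  then obtain R where R: "\<And>t. t \<in> {0..T} \<Longrightarrow> norm (x t) \<le> R" by (meson bounded_iff imageI)
  obtain L where L: "L-lipschitz_on (cball 0 (R + 1)) F" "0 \<le> L" using F by (rule locally_LipschitzE)
  have lim: "(\<lambda>k. norm (z - \<zeta> k) * exp (L * T)) \<longlonglongrightarrow> 0"
    using tendsto_mult[OF tendsto_norm[OF tendsto_diff[OF tendsto_const \<zeta>]] tendsto_const, of z "exp (L * T)"] by simp
  \<comment> \<open>From here on the Gronwall bound lies strictly below the tube radius 1, as the
    barrier argument requires.\<close>
  have "eventually (\<lambda>k. norm (z - \<zeta> k) * exp (L * T) < 1) sequentially"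
    using lim by (rule order_tendstoD) simp
  then have "eventually (\<lambda>k. dist (y k T) (x T) \<le> norm (z - \<zeta> k) * exp (L * T)) sequentially"
  proof eventually_elim
    case (elim k)
    have yc: "continuous_on {0..T} (y k)" using y by (simp add: forced_solution_def)
    have close: "dist (x t) (y k t) \<le> norm (z - \<zeta> k) * exp (L * t)"
      if t: "t \<in> {0..T}" and d: "\<And>s. s \<in> {0..t} \<Longrightarrow> dist (x s) (y k s) \<le> 1" for t
    proof -
      have "x s \<in> cball 0 (R + 1) \<and> y k s \<in> cball 0 (R + 1)" if "s \<in> {0..t}" for s
        using R[of s] d[OF that] that t norm_triangle_sub[of "y k s" "x s"] by (auto simp: dist_norm norm_minus_commute)
      then have "dist (x t) (y k t) \<le> (norm (z - \<zeta> k) + 0) * exp (L * t)"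
        using t by (intro forced_solutions_close[OF forced_solution_subset[OF x] forced_solution_subset[OF y] _ L(1)]) auto
      then show ?thesis by simp
    qed
    have lt: "norm (z - \<zeta> k) * exp (L * t) < 1" if "t \<in> {0..T}" for t
      using that L(2) by (intro le_less_trans[OF _ elim] mult_left_mono) (auto intro: mult_left_mono)
    have "dist (x t) (y k t) < 1" if "t \<in> {0..T}" for t
    proof (rule continuous_barrier[OF _ _ _ that])
      show "continuous_on {0..T} (\<lambda>t. dist (x t) (y k t))" using xc yc by (intro continuous_intros)
      show "dist (x 0) (y k 0) \<le> 1"
        using forced_solution_0[OF x T] forced_solution_0[OF y T, of k] lt[of 0] T by (simp add: dist_norm)
    qed (use close lt in \<open>auto intro: le_less_trans\<close>)
    then show ?case using T by (subst dist_commute, intro close) (auto intro: less_imp_le)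
  qed
  then have "eventually (\<lambda>k. norm (y k T - x T) \<le> norm (z - \<zeta> k) * exp (L * T)) sequentially"
    by (simp add: dist_norm)
  then have "(\<lambda>k. y k T - x T) \<longlonglongrightarrow> 0"
    by (rule Lim_null_comparison[OF _ lim])
  then show ?thesis by (simp add: LIM_zero_iff)
qed

text \<open>All paths start from the same data up to forcings of size \<open>\<delta> k\<close>, so
  Gronwall makes them Cauchy at each time, and no compactness of path space is involved. The limit
  is a global solution of the unforced equation, whose existence is thus part of the
  conclusion.\<close>

lemma forced_solution_limit:
  fixes F :: "'a::euclidean_space \<Rightarrow> 'a"
  assumes F: "locally_Lipschitz F"
    and x: "\<And>k. forced_solution F z (W k) (real k) (x k)"
    and W: "\<And>k t. t \<in> {0..real k} \<Longrightarrow> norm (W k t) \<le> \<delta> k" and \<delta>: "\<delta> \<longlonglongrightarrow> 0"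
    and R: "\<And>k t. t \<in> {0..real k} \<Longrightarrow> norm (x k t) \<le> R"
  obtains \<phi> where "\<And>t. 0 \<le> t \<Longrightarrow> (\<lambda>k. x k t) \<longlonglongrightarrow> \<phi> t" "\<phi> 0 = z"
    "\<And>t. 0 \<le> t \<Longrightarrow> (\<phi> has_vector_derivative F (\<phi> t)) (at t within {0..})"
proof -
  obtain L where L: "L-lipschitz_on (cball 0 R) F" "0 \<le> L" using F by (rule locally_LipschitzE)
  have close: "dist (x k t) (x l t) \<le> (\<delta> k + \<delta> l) * exp (L * T)"
    if "T \<le> real k" "T \<le> real l" "t \<in> {0..T}" for k l t T
  proof -
    have "dist (x k t) (x l t) \<le> (0 + (\<delta> k + \<delta> l)) * exp (L * t)"
    proof (rule forced_solutions_close[OF forced_solution_subset[OF x] forced_solution_subset[OF x] _ L(1)])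
      fix s assume "s \<in> {0..T}"
      then show "norm (W k s - W l s) \<le> \<delta> k + \<delta> l"
        using that W[of s k] W[of s l] by (intro norm_triangle_le_diff) auto
    qed (use that R in auto)
    also have "\<dots> \<le> (\<delta> k + \<delta> l) * exp (L * T)"
    proof -
      have "0 \<le> \<delta> k" "0 \<le> \<delta> l"
        using W[of t k] W[of t l] that norm_ge_zero order_trans by (auto simp: order_trans[OF norm_ge_zero])
      then show ?thesis using that L(2) by (auto intro!: mult_mono)
    qed
    finally show ?thesis .
  qed
  have "Cauchy (\<lambda>k. x k t)" if t: "0 \<le> t" for t
  proof (rule metric_CauchyI)
    fix e :: real assume e: "0 < e"
    have "(\<lambda>k. \<delta> k * exp (L * t)) \<longlonglongrightarrow> 0"
      using tendsto_mult[OF \<delta> tendsto_const, of "exp (L * t)"] by simp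
    from order_tendstoD(2)[OF this, of "e / 2"] e
    have "eventually (\<lambda>k. \<delta> k * exp (L * t) < e / 2 \<and> t \<le> real k) sequentially"
      using filterlim_real_sequentially[unfolded filterlim_at_top, rule_format, of t]
      by (auto intro: eventually_conj)
    then obtain N where N: "\<And>k. N \<le> k \<Longrightarrow> \<delta> k * exp (L * t) < e / 2 \<and> t \<le> real k"
      by (auto simp: eventually_sequentially)
    have "dist (x m t) (x n t) < e" if "N \<le> m" "N \<le> n" for m n
      using close[of t m n t] N[OF that(1)] N[OF that(2)] t by (auto simp: algebra_simps)
    then show "\<exists>N. \<forall>m\<ge>N. \<forall>n\<ge>N. dist (x m t) (x n t) < e" by blast
  qed
  then have "\<exists>l. (\<lambda>k. x k t) \<longlonglongrightarrow> l" if "0 \<le> t" for t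
    using that by (simp add: Cauchy_convergent_iff convergent_def)
  then obtain \<phi> where \<phi>: "\<And>t. 0 \<le> t \<Longrightarrow> (\<lambda>k. x k t) \<longlonglongrightarrow> \<phi> t" by metis
  have \<phi>R: "norm (\<phi> t) \<le> R" if "0 \<le> t" for t
  proof (rule Lim_bounded[OF tendsto_norm[OF \<phi>[OF that]]])
    show "\<forall>k\<ge>nat \<lceil>t\<rceil>. norm (x k t) \<le> R" using R that by (auto simp: nat_le_iff ceiling_le_iff)
  qed
  have \<phi>0: "\<phi> 0 = z"
  proof -
    have "norm (x k 0 - z) \<le> \<delta> k" for k
      using forced_solution_0[OF x, of k] W[of 0 k] by simp
    then have "(\<lambda>k. x k 0 - z) \<longlonglongrightarrow> 0"
      by (intro Lim_null_comparison[OF _ \<delta>]) auto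
    then show ?thesis using \<phi>[of 0] LIMSEQ_unique by (auto simp: LIM_zero_iff)
  qed
  have step: "continuous_on {0..T} \<phi> \<and> ((\<lambda>s. F (\<phi> s)) has_integral \<phi> T - z) {0..T}" if T: "0 \<le> T" for T
  proof -
    \<comment> \<open>After a shift by \<open>N\<close> every path is defined on all of
      \<open>{0..T}\<close>.\<close>
    define N where "N = nat \<lceil>T\<rceil>"
    have N: "T \<le> real (k + N)" for k unfolding N_def by linarith
    define y where "y k = x (k + N)" for k
    have \<delta>N: "(\<lambda>k. \<delta> (k + N)) \<longlonglongrightarrow> 0" using \<delta> by (rule LIMSEQ_ignore_initial_segment)
    have y: "forced_solution F z (W (k + N)) T (y k)" for k
      unfolding y_def by (rule forced_solution_subset[OF x N])
    have yR: "norm (y k t) \<le> R" if "t \<in> {0..T}" for k t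
      unfolding y_def using that N[of k] by (intro R) auto
    have yc: "continuous_on {0..T} (y k)" for k using y[of k] by (simp add: forced_solution_def)
    \<comment> \<open>The Cauchy estimate with the second index sent to infinity; being independent
      of \<open>t\<close>, it gives uniform convergence.\<close>
    have d: "dist (y k t) (\<phi> t) \<le> \<delta> (k + N) * exp (L * T)" if t: "t \<in> {0..T}" for k t
    proof (rule LIMSEQ_le)
      show "(\<lambda>l. dist (y k t) (y l t)) \<longlonglongrightarrow> dist (y k t) (\<phi> t)"
        unfolding y_def using t LIMSEQ_ignore_initial_segment[OF \<phi>[of t], of N]
        by (intro tendsto_dist tendsto_const) auto
      show "(\<lambda>l. (\<delta> (k + N) + \<delta> (l + N)) * exp (L * T)) \<longlonglongrightarrow> \<delta> (k + N) * exp (L * T)"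
        using tendsto_mult[OF tendsto_add[OF tendsto_const \<delta>N] tendsto_const, of "\<delta> (k + N)" "exp (L * T)"] by simp
      show "\<exists>M. \<forall>l\<ge>M. dist (y k t) (y l t) \<le> (\<delta> (k + N) + \<delta> (l + N)) * exp (L * T)"
        unfolding y_def using close[OF N N t] by blast
    qed
    have lim0: "(\<lambda>k. \<delta> (k + N) * exp (L * T)) \<longlonglongrightarrow> 0"
      using tendsto_mult[OF \<delta>N tendsto_const, of "exp (L * T)"] by simp
    have ul: "uniform_limit {0..T} y \<phi> sequentially"
    proof (rule uniform_limitI)
      fix e :: real assume "0 < e"
      from order_tendstoD(2)[OF lim0 this]
      show "\<forall>\<^sub>F k in sequentially. \<forall>t\<in>{0..T}. dist (y k t) (\<phi> t) < e"
        by eventually_elim (meson d le_less_trans)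
    qed
    have c: "continuous_on {0..T} \<phi>"
      by (rule uniform_limit_theorem[OF _ ul]) (use yc in auto)
    have ulF: "uniform_limit {0..T} (\<lambda>k t. F (y k t)) (\<lambda>t. F (\<phi> t)) sequentially"
    proof (rule uniform_limitI)
      fix e :: real assume e: "0 < e"
      have "(\<lambda>k. L * (\<delta> (k + N) * exp (L * T))) \<longlonglongrightarrow> 0"
        using tendsto_mult[OF tendsto_const lim0, of L] by simp
      from order_tendstoD(2)[OF this e]
      show "\<forall>\<^sub>F k in sequentially. \<forall>t\<in>{0..T}. dist (F (y k t)) (F (\<phi> t)) < e"
      proof (eventually_elim, safe)
        fix k t assume *: "L * (\<delta> (k + N) * exp (L * T)) < e" and t: "t \<in> {0..T}"
        have "dist (F (y k t)) (F (\<phi> t)) \<le> L * dist (y k t) (\<phi> t)"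
          using yR[OF t, of k] \<phi>R[of t] t by (intro lipschitz_onD[OF L(1)]) auto
        also have "\<dots> \<le> L * (\<delta> (k + N) * exp (L * T))" using d[OF t] L(2) by (intro mult_left_mono)
        finally show "dist (F (y k t)) (F (\<phi> t)) < e" using * by simp
      qed
    qed
    have "continuous_on {0..T} (\<lambda>t. F (y k t))" for k
      by (rule continuous_on_compose2[OF locally_Lipschitz_continuous[OF F, of UNIV] yc]) auto
    then obtain I J where IJ: "\<And>k. ((\<lambda>t. F (y k t)) has_integral I k) {0..T}"
      "((\<lambda>t. F (\<phi> t)) has_integral J) {0..T}" "I \<longlonglongrightarrow> J"
      using uniform_limit_integral[OF ulF] by auto
    have Ik: "I k = y k T - z - W (k + N) T" for k
      using IJ(1)[of k] y[of k] T by (intro has_integral_unique[OF IJ(1)]) (auto simp: forced_solution_def)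
    have "(\<lambda>k. y k T - z - W (k + N) T) \<longlonglongrightarrow> \<phi> T - z - 0"
    proof (intro tendsto_diff tendsto_const)
      show "(\<lambda>k. y k T) \<longlonglongrightarrow> \<phi> T" unfolding y_def using \<phi>[OF T] by (rule LIMSEQ_ignore_initial_segment)
      show "(\<lambda>k. W (k + N) T) \<longlonglongrightarrow> 0"
        by (rule Lim_null_comparison[OF _ \<delta>N]) (use W N T in auto)
    qed
    then have "I \<longlonglongrightarrow> \<phi> T - z" by (simp flip: Ik)
    with IJ(3) have "J = \<phi> T - z" by (rule LIMSEQ_unique)
    with IJ(2) c show ?thesis by simp
  qed
  have "(\<phi> has_vector_derivative F (\<phi> t)) (at t within {0..})" if t: "0 \<le> t" for t
  proof -
    \<comment> \<open>The interval reaches beyond \<open>t\<close>, so that the derivative within it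
      is the derivative within the half-line.\<close>
    have c: "continuous_on {0..t + 1} (\<lambda>s. F (\<phi> s))"
      by (rule continuous_on_compose2[OF locally_Lipschitz_continuous[OF F, of UNIV]]) (use step[of "t + 1"] t in auto)
    have eq: "z + integral {0..s} (\<lambda>s. F (\<phi> s)) = \<phi> s" if "0 \<le> s" for s
      using integral_unique[OF conjunct2[OF step[OF that]]] by simp
    have "((\<lambda>s. z + integral {0..s} (\<lambda>s. F (\<phi> s))) has_vector_derivative 0 + F (\<phi> t)) (at t within {0..t + 1})"
      by (intro has_vector_derivative_add has_vector_derivative_const integral_has_vector_derivative[OF c]) (use t in auto)
    then have "(\<phi> has_vector_derivative F (\<phi> t)) (at t within {0..t + 1})"
      using t by (intro has_vector_derivative_transform[OF _ eq[symmetric]]) simp_all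
    moreover have "at t within {0..t + 1} = at t within {0..}"
      by (rule at_within_nhd[of _ "{..<t + 1}"]) auto
    ultimately show ?thesis by simp
  qed
  with that \<phi> \<phi>0 show ?thesis by blast
qed

text \<open>Subtracting the forcing makes the path differentiable, and the energy grows at most at a rate
  proportional to the size of the forcing as long as the path stays in a ball.\<close>

lemma forced_solution_bounded:
  fixes F G :: "'a::euclidean_space \<Rightarrow> 'a" and H :: "'a \<Rightarrow> real"
  assumes F: "locally_Lipschitz F"
    and H: "\<And>y. (H has_derivative (\<lambda>h. G y \<bullet> h)) (at y)" and G: "continuous_on UNIV G"
    and dissip: "\<And>y. G y \<bullet> F y \<le> 0"
    and sub: "\<And>y. H y < h + 1 \<Longrightarrow> norm y < R" and z: "H z \<le> h"
  shows "\<exists>\<eta>>0. \<forall>W x. forced_solution F z W T x \<longrightarrow> (\<forall>s\<in>{0..T}. norm (W s) \<le> \<eta>) \<longrightarrow>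
    (\<forall>t\<in>{0..T}. norm (x t) \<le> R + 1)"
proof -
  obtain L where L: "L-lipschitz_on (cball 0 (R + 1)) F" "0 \<le> L" using F by (rule locally_LipschitzE)
  have "bounded (G ` cball 0 R)"
    by (intro compact_imp_bounded compact_continuous_image continuous_on_subset[OF G]) auto
  then obtain C where C: "0 < C" "\<And>y. norm y \<le> R \<Longrightarrow> norm (G y) \<le> C" by (force simp: bounded_pos)
  \<comment> \<open>The energy gained up to time \<open>T\<close> is at most
    \<open>C * L * \<eta> * T\<close>, which this choice keeps below 1; hence \<open>H\<close> stays
    below \<open>h + 1\<close>. The cap 1 keeps \<open>x\<close> within distance 1 of the path
    without forcing, and the \<open>+ 1\<close> avoids a zero denominator.\<close>
  define \<eta> where "\<eta> = min 1 (1 / (2 * (C * L * \<bar>T\<bar> + 1)))"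
  have pos: "0 < C * L * \<bar>T\<bar> + 1"
    using C L(2) by (simp add: add_nonneg_pos)
  have \<eta>: "0 < \<eta>" "\<eta> \<le> 1" "C * L * \<eta> * \<bar>T\<bar> < 1"
  proof -
    show "0 < \<eta>" "\<eta> \<le> 1" using pos by (auto simp: \<eta>_def)
    have "C * L * \<eta> * \<bar>T\<bar> \<le> (C * L * \<bar>T\<bar>) * (1 / (2 * (C * L * \<bar>T\<bar> + 1)))"
      using C L(2) unfolding \<eta>_def by (simp only: mult.assoc mult.commute[of "min _ _"]) (intro mult_left_mono, auto)
    also have "\<dots> < 1" using pos by (simp add: field_simps)
    finally show "C * L * \<eta> * \<bar>T\<bar> < 1" .
  qed
  have "norm (x t) \<le> R + 1"
    if x: "forced_solution F z W T x" and W: "\<And>s. s \<in> {0..T} \<Longrightarrow> norm (W s) \<le> \<eta>" and t: "t \<in> {0..T}" for W x t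
  proof -
    \<comment> \<open>Differentiable although \<open>x\<close> need not be: its derivative is
      \<open>F (x s)\<close>.\<close>
    define y where "y s = x s - W s" for s
    have T: "0 \<le> T" using t by auto
    have xc: "continuous_on {0..T} x" using x by (simp add: forced_solution_def)
    have Fx: "continuous_on {0..T} (\<lambda>s. F (x s))"
      by (rule continuous_on_compose2[OF locally_Lipschitz_continuous[OF F, of UNIV] xc]) auto
    have yeq: "z + integral {0..s} (\<lambda>s. F (x s)) = y s" if "s \<in> {0..T}" for s
    proof -
      have "((\<lambda>s. F (x s)) has_integral (x s - z - W s)) {0..s}"
        using x that unfolding forced_solution_def by blast
      then show ?thesis by (simp add: integral_unique y_def)
    qed
    have dy: "(y has_vector_derivative F (x s)) (at s within {0..T})" if s: "s \<in> {0..T}" for s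
    proof -
      have "((\<lambda>s. z + integral {0..s} (\<lambda>s. F (x s))) has_vector_derivative 0 + F (x s)) (at s within {0..T})"
        by (intro has_vector_derivative_add has_vector_derivative_const integral_has_vector_derivative[OF Fx s])
      then show ?thesis
        by (intro has_vector_derivative_transform[OF s yeq[symmetric]]) simp_all
    qed
    have yc: "continuous_on {0..T} y"
      unfolding continuous_on_eq_continuous_within using dy has_vector_derivative_continuous by blast
    have y0: "y 0 = z" using forced_solution_0[OF x T] by (simp add: y_def)
    have dH: "((\<lambda>s. H (y s)) has_real_derivative G (y s) \<bullet> F (x s)) (at s within {0..T})" if s: "s \<in> {0..T}" for s
      using vector_derivative_diff_chain_within[OF dy[OF s] has_derivative_at_withinI[OF H]]
      by (simp add: o_def has_real_derivative_iff_has_vector_derivative)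
    have "norm (y t) < R"
    proof (rule continuous_barrier[OF _ _ _ t])
      show "continuous_on {0..T} (\<lambda>s. norm (y s))" using yc by (intro continuous_intros)
      show "norm (y 0) \<le> R" using sub[of z] z y0 by simp
      fix r assume r: "r \<in> {0..T}" and le: "\<And>s. s \<in> {0..r} \<Longrightarrow> norm (y s) \<le> R"
      \<comment> \<open>Had the drift been evaluated at \<open>y s\<close>, the product would be
        nonpositive by \<open>dissip\<close>; only the error from evaluating it at
        \<open>x s\<close> remains, and it is Lipschitz small.\<close>
      have bd: "G (y s) \<bullet> F (x s) \<le> C * L * \<eta>" if s: "s \<in> {0..r}" for s
      proof -
        have Ws: "norm (W s) \<le> \<eta>" using W s r by auto
        have "norm (x s) \<le> R + 1"
          using le[OF s] Ws \<eta>(2) norm_triangle_ineq[of "y s" "W s"] by (simp add: y_def)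
        then have "dist (F (x s)) (F (y s)) \<le> L * dist (x s) (y s)"
          using le[OF s] by (intro lipschitz_onD[OF L(1)]) auto
        also have "\<dots> \<le> L * \<eta>" using Ws L(2) by (intro mult_left_mono) (auto simp: y_def dist_norm)
        finally have "norm (F (x s) - F (y s)) \<le> L * \<eta>" by (simp add: dist_norm)
        then have "norm (G (y s)) * norm (F (x s) - F (y s)) \<le> C * (L * \<eta>)"
          using C le[OF s] by (intro mult_mono) auto
        then have "G (y s) \<bullet> (F (x s) - F (y s)) \<le> C * (L * \<eta>)"
          using norm_cauchy_schwarz order_trans by blast
        with dissip[of "y s"] show ?thesis by (simp add: inner_diff_right)
      qed
      obtain q where q: "q \<in> {0..r}" "H (y r) - H (y 0) = G (y q) \<bullet> F (x q) * (r - 0)"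
      proof -
        have "\<exists>q\<in>{0..r}. H (y r) - H (y 0) = G (y q) \<bullet> F (x q) * (r - 0)"
        proof (rule mvt_very_simple)
          fix s assume "0 \<le> s" "s \<le> r"
          with dH[of s] r show "((\<lambda>s. H (y s)) has_derivative (*) (G (y s) \<bullet> F (x s))) (at s within {0..r})"
            unfolding has_field_derivative_def by (auto elim: has_derivative_subset)
        qed (use r in auto)
        then show ?thesis using that by blast
      qed
      have "H (y r) - H z \<le> C * L * \<eta> * r"
        using q bd[OF q(1)] r y0 by (auto intro: mult_right_mono)
      also have "\<dots> \<le> C * L * \<eta> * \<bar>T\<bar>"
        using r C L(2) \<eta>(1) by (intro mult_left_mono) auto
      finally show "norm (y r) < R" using \<eta>(3) z by (intro sub) simp
    qed
    then show ?thesis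
      using W[OF t] \<eta>(2) norm_triangle_ineq[of "y t" "W t"] by (simp add: y_def)
  qed
  with \<eta>(1) show ?thesis by blast
qed

text \<open>Dissipation makes the energy nonincreasing, \<open>ge\<close> keeps it above its initial
  value, so it is constant and its derivative vanishes.\<close>

lemma trajectory_energy_constant:
  fixes F G :: "'a::euclidean_space \<Rightarrow> 'a" and H :: "'a \<Rightarrow> real"
  assumes H: "\<And>y. (H has_derivative (\<lambda>h. G y \<bullet> h)) (at y)"
    and dissip: "\<And>y. G y \<bullet> F y \<le> 0"
    and \<phi>: "\<And>t. 0 \<le> t \<Longrightarrow> (\<phi> has_vector_derivative F (\<phi> t)) (at t within {0..})"
    and ge: "\<And>t. 0 \<le> t \<Longrightarrow> H (\<phi> 0) \<le> H (\<phi> t)" and t: "0 \<le> t"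
  shows "G (\<phi> t) \<bullet> F (\<phi> t) = 0"
proof -
  have dH: "((\<lambda>s. H (\<phi> s)) has_vector_derivative G (\<phi> s) \<bullet> F (\<phi> s)) (at s within {0..})" if s: "0 \<le> s" for s
    using vector_derivative_diff_chain_within[OF \<phi>[OF s] has_derivative_at_withinI[OF H]]
    by (simp add: o_def)
  have eq: "H (\<phi> 0) = H (\<phi> s)" if s: "0 \<le> s" for s
  proof (rule antisym[OF ge[OF s]])
    have "\<exists>q\<in>{0..s}. H (\<phi> s) - H (\<phi> 0) = (s - 0) *\<^sub>R (G (\<phi> q) \<bullet> F (\<phi> q))"
    proof (rule mvt_very_simple[OF s])
      fix q :: real assume "0 \<le> q"
      from dH[OF this] show "((\<lambda>s. H (\<phi> s)) has_derivative (\<lambda>x. x *\<^sub>R (G (\<phi> q) \<bullet> F (\<phi> q)))) (at q within {0..s})"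
        unfolding has_vector_derivative_def by (rule has_derivative_subset) auto
    qed
    then obtain q where "H (\<phi> s) - H (\<phi> 0) = s * (G (\<phi> q) \<bullet> F (\<phi> q))" by auto
    then show "H (\<phi> s) \<le> H (\<phi> 0)" using s dissip[of "\<phi> q"] by (smt (verit) mult_nonneg_nonpos)
  qed
  have "((\<lambda>s. H (\<phi> s)) has_vector_derivative 0) (at t within {0..})"
    by (rule has_vector_derivative_transform[OF _ _ has_vector_derivative_const[of "H (\<phi> 0)"]]) (use t eq in auto)
  \<comment> \<open>Derivatives within the half-line are unique, also at the endpoint 0, because
    \<open>t\<close> is a limit point.\<close>
  moreover have "at t within {0..} \<noteq> bot"
    using t by (simp add: trivial_limit_within islimpt_greaterThanLessThan1 islimpt_subset[of t "{t<..<t+1}"] subset_eq)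
  ultimately show ?thesis
    using vector_derivative_unique_within dH[OF t] by blast
qed

section \<open>The Hamiltonian and the drift\<close>

lemma locally_LipschitzI:
  fixes f :: "'a::real_normed_vector \<Rightarrow> 'b::real_normed_vector"
  assumes "\<And>R. 0 \<le> R \<Longrightarrow> \<exists>L. \<forall>x y. norm x \<le> R \<longrightarrow> norm y \<le> R \<longrightarrow> norm (f x - f y) \<le> L * norm (x - y)"
  shows "locally_Lipschitz f"
  unfolding locally_Lipschitz_def
proof
  fix R :: real
  obtain L where L: "\<And>x y. norm x \<le> \<bar>R\<bar> \<Longrightarrow> norm y \<le> \<bar>R\<bar> \<Longrightarrow> norm (f x - f y) \<le> L * norm (x - y)"
    using assms[of "\<bar>R\<bar>"] by auto
  have "\<bar>L\<bar>-lipschitz_on (cball 0 R) f"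
  proof (rule lipschitz_onI)
    fix x y :: 'a assume "x \<in> cball 0 R" "y \<in> cball 0 R"
    then have "norm (f x - f y) \<le> L * norm (x - y)" by (intro L) auto
    also have "\<dots> \<le> \<bar>L\<bar> * norm (x - y)" by (intro mult_right_mono) auto
    finally show "dist (f x) (f y) \<le> \<bar>L\<bar> * dist x y" by (simp add: dist_norm)
  qed simp
  then show "\<exists>L. L-lipschitz_on (cball 0 R) f" by blast
qed

lemma locally_Lipschitz_add:
  assumes "locally_Lipschitz f" "locally_Lipschitz g"
  shows "locally_Lipschitz (\<lambda>x. f x + g x)"
  using assms lipschitz_on_add unfolding locally_Lipschitz_def by metis

lemma locally_Lipschitz_sum:
  assumes "\<And>i. i \<in> A \<Longrightarrow> locally_Lipschitz (f i)"
  shows "locally_Lipschitz (\<lambda>x. \<Sum>i\<in>A. f i x)"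
  using assms
proof (induction A rule: infinite_finite_induct)
  case (insert i A)
  then show ?case by (simp add: locally_Lipschitz_add)
qed (auto simp: locally_Lipschitz_def intro: lipschitz_on_constant)

lemma locally_Lipschitz_linear_comp:
  assumes f: "locally_Lipschitz f" and g: "bounded_linear g"
  shows "locally_Lipschitz (\<lambda>x. g (f x))"
proof (rule locally_LipschitzI)
  fix R :: real
  interpret g: bounded_linear g by fact
  obtain L where L: "L-lipschitz_on (cball 0 R) f" using f by (rule locally_LipschitzE)
  obtain K where K: "\<And>x. norm (g x) \<le> norm x * K" "0 \<le> K" using g.nonneg_bounded by blast
  have "norm (g (f x) - g (f y)) \<le> (L * K) * norm (x - y)" if "norm x \<le> R" "norm y \<le> R" for x y
  proof -
    have "norm (g (f x) - g (f y)) \<le> norm (f x - f y) * K" using K(1)[of "f x - f y"] by (simp add: g.diff)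
    also have "\<dots> \<le> (L * norm (x - y)) * K"
      using lipschitz_onD[OF L, of x y] that K(2) by (intro mult_right_mono) (auto simp: dist_norm)
    finally show ?thesis by (simp add: mult_ac)
  qed
  then show "\<exists>L. \<forall>x y. norm x \<le> R \<longrightarrow> norm y \<le> R \<longrightarrow> norm (g (f x) - g (f y)) \<le> L * norm (x - y)" by blast
qed

lemma locally_Lipschitz_comp_linear:
  assumes f: "locally_Lipschitz f" and g: "bounded_linear g"
  shows "locally_Lipschitz (\<lambda>x. f (g x))"
proof (rule locally_LipschitzI)
  fix R :: real
  interpret g: bounded_linear g by fact
  obtain K where K: "\<And>x. norm (g x) \<le> norm x * K" "0 \<le> K" using g.nonneg_bounded by blast
  obtain L where L: "L-lipschitz_on (cball 0 (R * K)) f" "0 \<le> L" using f by (rule locally_LipschitzE)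
  have b: "norm (g x) \<le> R * K" if "norm x \<le> R" for x
    using K(1)[of x] mult_right_mono[OF that K(2)] by linarith
  have "norm (f (g x) - f (g y)) \<le> (L * K) * norm (x - y)" if "norm x \<le> R" "norm y \<le> R" for x y
  proof -
    have "norm (f (g x) - f (g y)) \<le> L * norm (g x - g y)"
      using lipschitz_onD[OF L(1), of "g x" "g y"] b that by (auto simp: dist_norm)
    also have "\<dots> \<le> L * (norm (x - y) * K)"
      using K(1)[of "x - y"] L(2) by (intro mult_left_mono) (auto simp: g.diff)
    finally show ?thesis by (simp add: mult_ac)
  qed
  then show "\<exists>L. \<forall>x y. norm x \<le> R \<longrightarrow> norm y \<le> R \<longrightarrow> norm (f (g x) - f (g y)) \<le> L * norm (x - y)" by blast
qed

lemma locally_Lipschitz_linear: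
  "bounded_linear f \<Longrightarrow> locally_Lipschitz f"
  by (rule locally_Lipschitz_linear_comp[of "\<lambda>x. x"]) (auto simp: locally_Lipschitz_def intro: lipschitz_on_id)

lemma locally_Lipschitz_poly: "locally_Lipschitz (poly p)" for p :: "real poly"
proof (rule locally_LipschitzI)
  fix R :: real
  have "bounded (poly (pderiv p) ` cball 0 R)"
    by (intro compact_imp_bounded compact_continuous_image continuous_intros) auto
  then obtain C where C: "\<And>x. x \<in> cball 0 R \<Longrightarrow> norm (poly (pderiv p) x) \<le> C"
    unfolding bounded_iff by blast
  have "norm (poly p x - poly p y) \<le> C * norm (x - y)" if "norm x \<le> R" "norm y \<le> R" for x y
    by (rule field_differentiable_bound[of "cball 0 R" _ "poly (pderiv p)"])
      (use C that in \<open>auto intro!: has_field_derivative_at_within poly_DERIV\<close>)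
  then show "\<exists>L. \<forall>x y. norm x \<le> R \<longrightarrow> norm y \<le> R \<longrightarrow> norm (poly p x - poly p y) \<le> L * norm (x - y)" by blast
qed

section \<open>Convexity and coercivity\<close>

lemma convex_on_compose_linear_UNIV:
  assumes f: "convex_on UNIV f" and g: "linear g"
  shows "convex_on UNIV (\<lambda>x. f (g x))"
proof (rule convex_onI)
  interpret g: linear g by fact
  fix t :: real and x y assume "0 < t" "t < 1"
  then show "f (g ((1 - t) *\<^sub>R x + t *\<^sub>R y)) \<le> (1 - t) * f (g x) + t * f (g y)"
    using convex_onD[OF f, of t "g x" "g y"] by (simp add: g.add g.scaleR)
qed simp

lemma convex_on_sum_functions:
  assumes "\<And>i. i \<in> A \<Longrightarrow> convex_on UNIV (f i)"
  shows "convex_on UNIV (\<lambda>x. \<Sum>i\<in>A. f i x)"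
  using assms
proof (induction A rule: infinite_finite_induct)
  case (insert i A)
  then show ?case by (simp add: convex_on_add)
qed (auto simp: convex_on_def)

text \<open>On the unit sphere around \<open>c\<close> the function exceeds its minimum by some
  \<open>m > 0\<close>, by compactness. Convexity along rays from \<open>c\<close> then forces
  growth at least linear with slope \<open>m\<close> outside the unit ball.\<close>

lemma convex_unique_minimum_coercive:
  fixes f :: "'a::euclidean_space \<Rightarrow> real"
  assumes f: "convex_on UNIV f" and cont: "continuous_on UNIV f" and min: "\<And>y. y \<noteq> c \<Longrightarrow> f c < f y"
  shows "\<exists>R. \<forall>y. f y < h \<longrightarrow> norm y < R"
proof -
  have "sphere c 1 \<noteq> {}"
  proof -
    obtain b :: 'a where "b \<in> Basis" using nonempty_Basis by blast
    then have "c + b \<in> sphere c 1" by (simp add: dist_norm)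
    then show ?thesis by blast
  qed
  then obtain p where p: "p \<in> sphere c 1" "\<And>y. y \<in> sphere c 1 \<Longrightarrow> f p \<le> f y"
    using continuous_attains_inf[OF compact_sphere _ continuous_on_subset[OF cont]] by (metis subset_UNIV)
  define m where "m = f p - f c"
  have m: "0 < m" using min[of p] p(1) by (cases "p = c") (auto simp: m_def)
  \<comment> \<open>The 1 covers points inside the unit ball around \<open>c\<close>; the quotient
    bounds the distance to \<open>c\<close> outside it, by linear growth.\<close>
  have "norm y < norm c + max 1 (\<bar>h - f c\<bar> / m) + 1" if y: "f y < h" for y
  proof (cases "dist c y \<le> 1")
    case True
    then show ?thesis using norm_triangle_sub[of y c] by (simp add: dist_norm norm_minus_commute)
  next
    case False
    define r where "r = dist c y"
    have r: "1 < r" using False by (simp add: r_def)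
    \<comment> \<open>The point where the segment from \<open>c\<close> to \<open>y\<close> meets
      the unit sphere.\<close>
    define q where "q = (1 - 1 / r) *\<^sub>R c + (1 / r) *\<^sub>R y"
    have "q - c = (1 / r) *\<^sub>R (y - c)" by (simp add: q_def algebra_simps)
    then have "norm (q - c) = 1" using r by (auto simp: r_def dist_norm norm_minus_commute)
    then have "f p \<le> f q" by (intro p(2)) (simp add: dist_norm norm_minus_commute)
    also have "f q \<le> (1 - 1 / r) * f c + (1 / r) * f y"
      unfolding q_def using r by (intro convex_onD[OF f]) auto
    finally have "m \<le> (f y - f c) / r" by (simp add: m_def algebra_simps diff_divide_distrib)
    then have "m * r \<le> f y - f c" using r by (simp add: pos_le_divide_eq)
    then have "r < \<bar>h - f c\<bar> / m" using y m by (simp add: pos_less_divide_eq mult.commute)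
    then show ?thesis using norm_triangle_sub[of y c] by (simp add: r_def dist_norm norm_minus_commute)
  qed
  then show ?thesis by blast
qed

section \<open>Gradient, dissipation identity and drift\<close>

definition potential :: "('v::finite \<Rightarrow> 'v \<Rightarrow> bool) \<Rightarrow> real poly \<Rightarrow> real poly \<Rightarrow> real ^ 'v \<Rightarrow> real" where
  "potential E V U q = (\<Sum>i\<in>UNIV. poly V (q $ i) + (\<Sum>j | E j i. poly U (q $ i - q $ j)) / 2)"

text \<open>The differential in direction \<open>h\<close>, as the chain rule delivers it. Keeping
  \<open>h\<close> avoids collecting, for each vertex, the interaction terms in which its position
  occurs first or second; the gradient is read off on basis vectors.\<close>

definition potential_deriv :: "('v::finite \<Rightarrow> 'v \<Rightarrow> bool) \<Rightarrow> real poly \<Rightarrow> real poly \<Rightarrow> real ^ 'v \<Rightarrow> real ^ 'v \<Rightarrow> real" where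
  "potential_deriv E V U q h = (\<Sum>i\<in>UNIV. poly (pderiv V) (q $ i) * h $ i
     + (\<Sum>j | E j i. poly (pderiv U) (q $ i - q $ j) * (h $ i - h $ j)) / 2)"

definition grad_potential :: "('v::finite \<Rightarrow> 'v \<Rightarrow> bool) \<Rightarrow> real poly \<Rightarrow> real poly \<Rightarrow> real ^ 'v \<Rightarrow> real ^ 'v" where
  "grad_potential E V U q = (\<chi> i. potential_deriv E V U q (axis i 1))"

lemma has_derivative_poly [derivative_intros]:
  fixes p :: "real poly"
  assumes "(f has_derivative f') (at x within S)"
  shows "((\<lambda>x. poly p (f x)) has_derivative (\<lambda>h. poly (pderiv p) (f x) * f' h)) (at x within S)"
  using has_derivative_compose[OF assms, of "poly p" "(*) (poly (pderiv p) (f x))"] poly_DERIV[of p "f x"]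
  by (simp add: has_field_derivative_def)

lemma has_derivative_potential:
  "(potential E V U has_derivative potential_deriv E V U q) (at q)"
  unfolding potential_def[abs_def] potential_deriv_def[abs_def]
  by (auto intro!: derivative_eq_intros bounded_linear.has_derivative[OF bounded_linear_vec_nth] simp: fun_eq_iff)

lemma potential_deriv_eq_inner: "potential_deriv E V U q h = grad_potential E V U q \<bullet> h"
proof -
  interpret linear "potential_deriv E V U q"
    using has_derivative_potential by (rule has_derivative_linear)
  have "potential_deriv E V U q h = potential_deriv E V U q (\<Sum>i\<in>UNIV. h $ i *\<^sub>R axis i 1)"
    using basis_expansion[of h] by (simp add: scalar_mult_eq_scaleR)
  also have "\<dots> = grad_potential E V U q \<bullet> h"
    by (simp add: sum scaleR inner_vec_def grad_potential_def mult.commute)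
  finally show ?thesis .
qed

lemma locally_Lipschitz_grad_potential:
  fixes E :: "'v::finite \<Rightarrow> 'v \<Rightarrow> bool"
  shows "locally_Lipschitz (grad_potential E V U)"
proof -
  have 1: "locally_Lipschitz (\<lambda>q. poly p (g q) * a)"
    if "bounded_linear g" for p :: "real poly" and g :: "real ^ 'v \<Rightarrow> real" and a
    by (intro locally_Lipschitz_linear_comp[OF locally_Lipschitz_comp_linear[OF locally_Lipschitz_poly that]]
        bounded_linear_mult_left)
  have "locally_Lipschitz (\<lambda>q. potential_deriv E V U q h)" for h
    unfolding potential_deriv_def divide_inverse
    by (intro locally_Lipschitz_sum locally_Lipschitz_add 1 bounded_linear_vec_nth bounded_linear_sub
        locally_Lipschitz_linear_comp[OF _ bounded_linear_mult_left])
  then have "locally_Lipschitz (\<lambda>q. \<Sum>i\<in>UNIV. potential_deriv E V U q (axis i 1) *\<^sub>R (axis i 1 :: real ^ 'v))"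
    by (intro locally_Lipschitz_sum locally_Lipschitz_linear_comp[OF _ bounded_linear_scaleR_left])
  also have "(\<lambda>q. \<Sum>i\<in>UNIV. potential_deriv E V U q (axis i 1) *\<^sub>R (axis i 1 :: real ^ 'v)) = grad_potential E V U"
  proof
    fix q show "(\<Sum>i\<in>UNIV. potential_deriv E V U q (axis i 1) *\<^sub>R (axis i 1 :: real ^ 'v)) = grad_potential E V U q"
      using basis_expansion[of "grad_potential E V U q"]
      by (simp add: scalar_mult_eq_scaleR grad_potential_def)
  qed
  finally show ?thesis .
qed

lemma hamiltonian_eq: "hamiltonian E V U z = (snd z \<bullet> snd z) / 2 + potential E V U (fst z)"
  by (simp add: hamiltonian_def potential_def sum.distrib inner_vec_def power2_eq_square
      add.assoc flip: sum_divide_distrib)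

definition grad_hamiltonian :: "('v::finite \<Rightarrow> 'v \<Rightarrow> bool) \<Rightarrow> real poly \<Rightarrow> real poly \<Rightarrow> 'v state \<Rightarrow> 'v state" where
  "grad_hamiltonian E V U z = (grad_potential E V U (fst z), snd z)"

lemma has_derivative_hamiltonian:
  "(hamiltonian E V U has_derivative (\<lambda>h. grad_hamiltonian E V U z \<bullet> h)) (at z)"
proof -
  have "((\<lambda>z. (snd z \<bullet> snd z) / 2 + potential E V U (fst z)) has_derivative
      (\<lambda>h. (snd z \<bullet> snd h + snd h \<bullet> snd z) / 2 + potential_deriv E V U (fst z) (fst h))) (at z)"
    by (auto intro!: derivative_eq_intros has_derivative_compose[OF has_derivative_fst[OF has_derivative_ident] has_derivative_potential])
  then show ?thesis
    by (simp add: hamiltonian_eq[abs_def] potential_deriv_eq_inner grad_hamiltonian_def inner_prod_def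
        inner_commute add.commute)
qed

text \<open>Varying one position is an affine map through \<open>z\<close> in direction
  \<open>axis i 1\<close>, so the chain rule applies. This ties the \<open>deriv\<close> of the
  model to the gradient, for which differentiability has been proved.\<close>

lemma partial_q_hamiltonian: "partial_q i (hamiltonian E V U) z = grad_potential E V U (fst z) $ i"
proof -
  define f where "f x = ((\<chi> j. if j = i then x else pos z j), snd z)" for x
  have f: "f x = ((fst z - pos z i *\<^sub>R axis i 1) + x *\<^sub>R axis i 1, snd z)" for x
    by (simp add: f_def vec_eq_iff axis_def)
  have "(f has_derivative (\<lambda>h. (h *\<^sub>R axis i 1, 0))) (at (pos z i))"
    unfolding f[abs_def] by (auto intro!: derivative_eq_intros)
  moreover have "f (pos z i) = z" by (simp add: f prod_eq_iff)
  ultimately have "((\<lambda>x. hamiltonian E V U (f x)) has_derivative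
      (\<lambda>h. grad_hamiltonian E V U z \<bullet> (h *\<^sub>R axis i 1, 0))) (at (pos z i))"
    using has_derivative_compose[of f _ "pos z i" UNIV "hamiltonian E V U"]
      has_derivative_hamiltonian[of E V U z] by simp
  also have "(\<lambda>h. grad_hamiltonian E V U z \<bullet> (h *\<^sub>R axis i 1, 0)) = (*) (grad_potential E V U (fst z) $ i)"
    by (simp add: fun_eq_iff grad_hamiltonian_def inner_axis mult.commute)
  finally have "((\<lambda>x. hamiltonian E V U (f x)) has_field_derivative grad_potential E V U (fst z) $ i) (at (pos z i))"
    by (simp add: has_field_derivative_def)
  then show ?thesis unfolding partial_q_def f_def by (rule DERIV_imp_deriv)
qed

text \<open>Phrased with \<open>partial_q\<close> so that its coordinates are literally the
  integrands of \<open>heat_network_solution\<close>.\<close>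

definition network_drift :: "('v::finite \<Rightarrow> 'v \<Rightarrow> bool) \<Rightarrow> real poly \<Rightarrow> real poly \<Rightarrow> 'v set \<Rightarrow> 'v state \<Rightarrow> 'v state" where
  "network_drift E V U D z =
     (snd z, \<chi> i. - partial_q i (hamiltonian E V U) z - (if i \<in> D then mom z i else 0))"

lemma locally_Lipschitz_network_drift:
  fixes E :: "'v::finite \<Rightarrow> 'v \<Rightarrow> bool"
  shows "locally_Lipschitz (network_drift E V U D)"
proof -
  have lin: "bounded_linear (\<lambda>z. (snd z, \<chi> i. - (if i \<in> D then mom z i else 0)) :: 'v state)"
    unfolding linear_conv_bounded_linear[symmetric]
    by (rule linearI) (auto simp: prod_eq_iff vec_eq_iff)
  have "locally_Lipschitz (\<lambda>z :: 'v state. (0 :: real ^ 'v, - grad_potential E V U (fst z)))"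
    by (rule locally_Lipschitz_linear_comp[OF locally_Lipschitz_comp_linear[OF
          locally_Lipschitz_grad_potential bounded_linear_fst]])
       (simp add: linear_conv_bounded_linear[symmetric] linear_iff)
  from locally_Lipschitz_add[OF this locally_Lipschitz_linear[OF lin]]
  have "locally_Lipschitz (\<lambda>z. (0, - grad_potential E V U (fst z)) + (snd z, \<chi> i. - (if i \<in> D then mom z i else 0)))" .
  also have "(\<lambda>z. (0, - grad_potential E V U (fst z)) + (snd z, \<chi> i. - (if i \<in> D then mom z i else 0))) = network_drift E V U D"
    by (auto simp: fun_eq_iff network_drift_def partial_q_hamiltonian prod_eq_iff vec_eq_iff)
  finally show ?thesis .
qed

text \<open>The conservative part of the drift is orthogonal to the gradient, so only the friction
  contributes: energy is lost exactly through the momenta at damped vertices.\<close>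

lemma grad_hamiltonian_inner_drift:
  "grad_hamiltonian E V U z \<bullet> network_drift E V U D z = - (\<Sum>i\<in>D. (mom z i)\<^sup>2)"
proof -
  have "(\<Sum>i\<in>UNIV. mom z i * (if i \<in> D then mom z i else 0)) = (\<Sum>i\<in>D. (mom z i)\<^sup>2)"
    by (simp add: if_distrib power2_eq_square sum.If_cases cong: if_cong)
  then show ?thesis
    by (simp add: grad_hamiltonian_def network_drift_def inner_vec_def partial_q_hamiltonian
        algebra_simps sum_subtractf sum_negf)
qed

lemma continuous_on_grad_hamiltonian: "continuous_on S (grad_hamiltonian E V U)"
  unfolding grad_hamiltonian_def[abs_def]
  by (intro continuous_intros continuous_on_compose2[OF
        locally_Lipschitz_continuous[OF locally_Lipschitz_grad_potential, of UNIV]]) auto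

lemma continuous_on_hamiltonian: "continuous_on S (hamiltonian E V U)"
  using has_derivative_hamiltonian has_derivative_continuous
  by (intro continuous_at_imp_continuous_on) blast

lemma convex_on_hamiltonian:
  fixes E :: "'v::finite \<Rightarrow> 'v \<Rightarrow> bool"
  assumes V: "convex_on UNIV (poly V)" and U: "convex_on UNIV (poly U)"
  shows "convex_on UNIV (hamiltonian E V U)"
proof -
  have "convex_on UNIV (\<lambda>z :: 'v state. inverse 2 * (mom z i)\<^sup>2)" for i
    by (intro convex_on_cmul convex_on_compose_linear_UNIV[OF convex_power2]) (auto simp: linear_iff)
  moreover have "convex_on UNIV (\<lambda>z :: 'v state. poly V (pos z i))" for i
    by (rule convex_on_compose_linear_UNIV[OF V]) (auto simp: linear_iff)
  moreover have "convex_on UNIV (\<lambda>z :: 'v state. inverse 2 * (\<Sum>j | E j i. poly U (pos z i - pos z j)))" for i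
    by (intro convex_on_cmul convex_on_sum_functions convex_on_compose_linear_UNIV[OF U])
       (auto simp: linear_iff algebra_simps)
  ultimately have "convex_on UNIV (\<lambda>z :: 'v state. \<Sum>i\<in>UNIV. inverse 2 * (mom z i)\<^sup>2 + poly V (pos z i)
      + inverse 2 * (\<Sum>j | E j i. poly U (pos z i - pos z j)))"
    by (intro convex_on_sum_functions convex_on_add)
  then show ?thesis by (simp add: hamiltonian_def[abs_def] field_simps)
qed

text \<open>Where the damped momenta vanish the friction vanishes too, so a trajectory of the damped
  flow solves the undamped system of the stability condition.\<close>

lemma stability_conditionD:
  assumes stab: "stability_condition (hamiltonian E V U) D c"
    and \<phi>: "\<And>t. 0 \<le> t \<Longrightarrow> (\<phi> has_vector_derivative network_drift E V U D (\<phi> t)) (at t within {0..})"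
    and D: "\<And>t i. 0 \<le> t \<Longrightarrow> i \<in> D \<Longrightarrow> mom (\<phi> t) i = 0"
  shows "\<phi> 0 = c"
proof -
  have p: "((\<lambda>s. pos (\<phi> s) i) has_real_derivative mom (\<phi> t) i) (at t within {0..})" if "0 \<le> t" for t i
    using bounded_linear.has_vector_derivative[OF bounded_linear_compose[OF bounded_linear_vec_nth bounded_linear_fst] \<phi>[OF that], of i]
    by (simp add: has_real_derivative_iff_has_vector_derivative network_drift_def)
  have m: "((\<lambda>s. mom (\<phi> s) i) has_real_derivative - partial_q i (hamiltonian E V U) (\<phi> t)) (at t within {0..})"
    if "0 \<le> t" for t i
    using bounded_linear.has_vector_derivative[OF bounded_linear_compose[OF bounded_linear_vec_nth bounded_linear_snd] \<phi>[OF that], of i]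
      D[OF that, of i]
    by (cases "i \<in> D") (simp_all add: has_real_derivative_iff_has_vector_derivative network_drift_def)
  from stab p m D show ?thesis unfolding stability_condition_def by blast
qed

section \<open>Small balls of Brownian motion\<close>

text \<open>With the first copy frozen, independence factors the integral over the second copy; what
  remains is a product of functions of the independent \<open>X i\<close>, and factors again. In
  effect the pairs of copies are independent over \<open>i\<close>.\<close>

lemma (in prob_space) nn_integral_pair_prod_indep:
  fixes X :: "'i \<Rightarrow> 'a \<Rightarrow> 'b::second_countable_topology" and f :: "'i \<Rightarrow> 'b \<times> 'b \<Rightarrow> ennreal"
  assumes I: "finite I" and indep: "indep_vars (\<lambda>_. borel) X I"
    and f [measurable]: "\<And>i. i \<in> I \<Longrightarrow> f i \<in> borel_measurable (borel \<Otimes>\<^sub>M borel)"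
  shows "(\<integral>\<^sup>+p. (\<Prod>i\<in>I. f i (X i (fst p), X i (snd p))) \<partial>(M \<Otimes>\<^sub>M M)) =
    (\<Prod>i\<in>I. \<integral>\<^sup>+p. f i (X i (fst p), X i (snd p)) \<partial>(M \<Otimes>\<^sub>M M))"
proof -
  have X [measurable]: "X i \<in> borel_measurable M" if "i \<in> I" for i
    using indep that by (auto simp: indep_vars_def)
  define \<phi> where "\<phi> i x = (\<integral>\<^sup>+w'. f i (x, X i w') \<partial>M)" for i x
  have \<phi> [measurable]: "\<phi> i \<in> borel_measurable borel" if [measurable]: "i \<in> I" for i
    unfolding \<phi>_def using that by measurable
  have "(\<integral>\<^sup>+p. (\<Prod>i\<in>I. f i (X i (fst p), X i (snd p))) \<partial>(M \<Otimes>\<^sub>M M)) =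
      (\<integral>\<^sup>+w. \<integral>\<^sup>+w'. (\<Prod>i\<in>I. f i (X i w, X i w')) \<partial>M \<partial>M)"
    by (subst nn_integral_fst[symmetric]) auto
  also have "\<dots> = (\<integral>\<^sup>+w. (\<Prod>i\<in>I. \<phi> i (X i w)) \<partial>M)"
  proof (rule nn_integral_cong)
    fix w assume "w \<in> space M"
    have "indep_vars (\<lambda>_. borel) (\<lambda>i w'. f i (X i w, X i w')) I"
      by (rule indep_vars_compose2[OF indep]) measurable
    then show "(\<integral>\<^sup>+w'. (\<Prod>i\<in>I. f i (X i w, X i w')) \<partial>M) = (\<Prod>i\<in>I. \<phi> i (X i w))"
      unfolding \<phi>_def by (intro indep_vars_nn_integral I) auto
  qed
  also have "\<dots> = (\<Prod>i\<in>I. \<integral>\<^sup>+w. \<phi> i (X i w) \<partial>M)"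
    by (intro indep_vars_nn_integral I indep_vars_compose2[OF indep]) auto
  also have "\<dots> = (\<Prod>i\<in>I. \<integral>\<^sup>+p. f i (X i (fst p), X i (snd p)) \<partial>(M \<Otimes>\<^sub>M M))"
    unfolding \<phi>_def by (intro prod.cong refl, subst nn_integral_fst[symmetric]) auto
  finally show ?thesis .
qed

text \<open>The difference of two independent copies doubles the variance; division by
  \<open>sqrt 2\<close> restores it.\<close>

lemma (in prob_space) distributed_symmetrized_normal:
  fixes X :: "'a \<Rightarrow> real"
  assumes X: "distributed M lborel X (normal_density 0 \<sigma>)" and \<sigma>: "0 < \<sigma>"
  shows "distributed (M \<Otimes>\<^sub>M M) lborel (\<lambda>p. (X (fst p) - X (snd p)) / sqrt 2) (normal_density 0 \<sigma>)"
proof -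
  interpret MM: pair_prob_space M M ..
  have Xm [measurable]: "X \<in> borel_measurable M"
    using distributed_measurable[OF X] by simp
  have d: "distr (M \<Otimes>\<^sub>M M) M fst = M" by (rule distr_pair_fst) unfold_locales
  have "distr (M \<Otimes>\<^sub>M M) M snd = distr (distr (M \<Otimes>\<^sub>M M) (M \<Otimes>\<^sub>M M) (\<lambda>(x, y). (y, x))) M snd"
    by (simp flip: MM.distr_pair_swap)
  also have "\<dots> = distr (M \<Otimes>\<^sub>M M) M fst"
    by (subst distr_distr) (auto simp: comp_def case_prod_beta')
  finally have d': "distr (M \<Otimes>\<^sub>M M) M snd = M" by (simp add: d)
  have 1: "distr (M \<Otimes>\<^sub>M M) lborel (\<lambda>p. X (fst p)) = distr M lborel X"
    by (subst (2) d[symmetric], subst distr_distr) (auto simp: comp_def)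
  have 2: "distr (M \<Otimes>\<^sub>M M) lborel (\<lambda>p. X (snd p)) = distr M lborel X"
    by (subst (2) d'[symmetric], subst distr_distr) (auto simp: comp_def)
  \<comment> \<open>Independence of the two copies is checked as equality of their joint law with
    the product of the marginals.\<close>
  have ind: "MM.indep_var borel (\<lambda>p. X (fst p)) borel (\<lambda>p. X (snd p))"
  proof (subst MM.indep_var_distribution_eq, safe)
    have "distr (M \<Otimes>\<^sub>M M) borel (\<lambda>p. X (fst p)) = distr M borel X"
       "distr (M \<Otimes>\<^sub>M M) borel (\<lambda>p. X (snd p)) = distr M borel X"
      using 1 2 by (simp_all add: distr_cong[OF refl sets_lborel refl])
    moreover have "distr M borel X \<Otimes>\<^sub>M distr M borel X =
        distr (M \<Otimes>\<^sub>M M) (borel \<Otimes>\<^sub>M borel) (\<lambda>(x, y). (X x, X y))"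
      by (rule pair_measure_distr) (auto intro!: prob_space_imp_sigma_finite prob_space_distr)
    ultimately show "distr (M \<Otimes>\<^sub>M M) borel (\<lambda>p. X (fst p)) \<Otimes>\<^sub>M distr (M \<Otimes>\<^sub>M M) borel (\<lambda>p. X (snd p)) =
       distr (M \<Otimes>\<^sub>M M) (borel \<Otimes>\<^sub>M borel) (\<lambda>x. (X (fst x), X (snd x)))"
      by (simp add: case_prod_beta')
  qed auto
  have n: "distributed (M \<Otimes>\<^sub>M M) lborel (\<lambda>p. X (fst p)) (normal_density 0 \<sigma>)"
    "distributed (M \<Otimes>\<^sub>M M) lborel (\<lambda>p. X (snd p)) (normal_density 0 \<sigma>)"
    using X 1 2 by (auto simp: distributed_def)
  have "distributed (M \<Otimes>\<^sub>M M) lborel (\<lambda>p. X (fst p) - X (snd p)) (normal_density (0 - 0) (sqrt (\<sigma>\<^sup>2 + \<sigma>\<^sup>2)))"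
    using \<sigma> by (intro MM.diff_indep_normal ind n) auto
  from MM.normal_density_affine[OF this, of "1 / sqrt 2" 0]
  show ?thesis using \<sigma>
    by (simp add: real_sqrt_mult[symmetric] flip: real_sqrt_divide) 
qed

text \<open>Both vectors have independent coordinates with the same normal laws, so they agree on
  boxes, and boxes determine a finite measure on the product.\<close>

lemma (in prob_space) distr_symmetrized_normal_vector:
  fixes X :: "'i \<Rightarrow> 'a \<Rightarrow> real"
  assumes I: "finite I" "I \<noteq> {}" and indep: "indep_vars (\<lambda>_. borel) X I"
    and \<sigma>: "\<And>i. i \<in> I \<Longrightarrow> 0 < \<sigma> i"
    and X: "\<And>i. i \<in> I \<Longrightarrow> distributed M lborel (X i) (normal_density 0 (\<sigma> i))"
  shows "distr (M \<Otimes>\<^sub>M M) (\<Pi>\<^sub>M i\<in>I. borel) (\<lambda>p. \<lambda>i\<in>I. (X i (fst p) - X i (snd p)) / sqrt 2) =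
    distr M (\<Pi>\<^sub>M i\<in>I. borel) (\<lambda>w. \<lambda>i\<in>I. X i w)"
proof -
  interpret MM: pair_prob_space M M ..
  have Xm [measurable]: "X i \<in> borel_measurable M" if "i \<in> I" for i
    using indep that by (auto simp: indep_vars_def)
  let ?Y = "\<lambda>i p. (X i (fst p) - X i (snd p)) / sqrt 2"
  have eq: "distr (M \<Otimes>\<^sub>M M) borel (?Y i) = distr M borel (X i)" if "i \<in> I" for i
  proof -
    have "distr (M \<Otimes>\<^sub>M M) lborel (?Y i) = distr M lborel (X i)"
      using distributed_symmetrized_normal[OF X[OF that] \<sigma>[OF that]] X[OF that]
      by (simp add: distributed_def)
    then show ?thesis by (simp add: distr_cong[OF refl sets_lborel refl])
  qed
  show ?thesis
  proof (rule measure_eqI_PiM_finite[OF I(1)])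
    fix A :: "'i \<Rightarrow> real set" assume Am [measurable]: "\<And>i. i \<in> I \<Longrightarrow> A i \<in> sets borel"
    have "emeasure (distr (M \<Otimes>\<^sub>M M) (\<Pi>\<^sub>M i\<in>I. borel) (\<lambda>p. \<lambda>i\<in>I. ?Y i p)) (Pi\<^sub>E I A) =
        emeasure (M \<Otimes>\<^sub>M M) ((\<lambda>p. \<lambda>i\<in>I. ?Y i p) -` (Pi\<^sub>E I A) \<inter> space (M \<Otimes>\<^sub>M M))"
      using I by (intro emeasure_distr sets_PiM_I_finite) (auto intro!: measurable_restrict)
    also have "\<dots> = (\<integral>\<^sup>+p. (\<Prod>i\<in>I. indicator {q. (fst q - snd q) / sqrt 2 \<in> A i} (X i (fst p), X i (snd p))) \<partial>(M \<Otimes>\<^sub>M M))"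
    proof (subst nn_integral_indicator[symmetric])
      show "(\<lambda>p. \<lambda>i\<in>I. ?Y i p) -` (Pi\<^sub>E I A) \<inter> space (M \<Otimes>\<^sub>M M) \<in> sets (M \<Otimes>\<^sub>M M)"
        by (rule measurable_sets[of _ _ "\<Pi>\<^sub>M i\<in>I. borel"])
           (use I in \<open>auto intro!: measurable_restrict sets_PiM_I_finite\<close>)
    next
      show "(\<integral>\<^sup>+p. indicator ((\<lambda>p. \<lambda>i\<in>I. ?Y i p) -` (Pi\<^sub>E I A) \<inter> space (M \<Otimes>\<^sub>M M)) p \<partial>(M \<Otimes>\<^sub>M M)) =
        (\<integral>\<^sup>+p. (\<Prod>i\<in>I. indicator {q. (fst q - snd q) / sqrt 2 \<in> A i} (X i (fst p), X i (snd p))) \<partial>(M \<Otimes>\<^sub>M M))"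
        by (intro nn_integral_cong) (use I in \<open>auto simp: indicator_def PiE_iff prod_zero_iff intro!: prod.neutral\<close>)
    qed
    also have "\<dots> = (\<Prod>i\<in>I. \<integral>\<^sup>+p. indicator {q. (fst q - snd q) / sqrt 2 \<in> A i} (X i (fst p), X i (snd p)) \<partial>(M \<Otimes>\<^sub>M M))"
      by (rule nn_integral_pair_prod_indep[OF I(1) indep]) measurable
    also have "\<dots> = (\<Prod>i\<in>I. emeasure M (X i -` A i \<inter> space M))"
    proof (intro prod.cong refl)
      fix i assume i [measurable]: "i \<in> I"
      have "emeasure M (X i -` A i \<inter> space M) = emeasure (distr M borel (X i)) (A i)"
        using i by (subst emeasure_distr) auto
      also have "\<dots> = emeasure (M \<Otimes>\<^sub>M M) (?Y i -` A i \<inter> space (M \<Otimes>\<^sub>M M))"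
        using i by (subst eq[symmetric], simp, subst emeasure_distr) auto
      also have "\<dots> = (\<integral>\<^sup>+p. indicator (?Y i -` A i \<inter> space (M \<Otimes>\<^sub>M M)) p \<partial>(M \<Otimes>\<^sub>M M))"
        by (rule nn_integral_indicator[symmetric]) (use i in measurable)
      also have "\<dots> = (\<integral>\<^sup>+p. indicator {q. (fst q - snd q) / sqrt 2 \<in> A i} (X i (fst p), X i (snd p)) \<partial>(M \<Otimes>\<^sub>M M))"
        by (intro nn_integral_cong) (auto simp: indicator_def)
      finally show "(\<integral>\<^sup>+p. indicator {q. (fst q - snd q) / sqrt 2 \<in> A i} (X i (fst p), X i (snd p)) \<partial>(M \<Otimes>\<^sub>M M)) =
        emeasure M (X i -` A i \<inter> space M)" by simp
    qed
    also have "\<dots> = emeasure M (\<Inter>i\<in>I. X i -` A i \<inter> space M)"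
      using indep_varsD_finite[OF indep I(2,1) Am] by (simp add: emeasure_eq_measure prod_ennreal)
    also have "(\<Inter>i\<in>I. X i -` A i \<inter> space M) = (\<lambda>w. \<lambda>i\<in>I. X i w) -` Pi\<^sub>E I A \<inter> space M"
      using I by (auto simp: PiE_iff)
    also have "emeasure M \<dots> = emeasure (distr M (\<Pi>\<^sub>M i\<in>I. borel) (\<lambda>w. \<lambda>i\<in>I. X i w)) (Pi\<^sub>E I A)"
      using I by (intro emeasure_distr[symmetric] sets_PiM_I_finite) (auto intro!: measurable_restrict)
    finally show "emeasure (distr (M \<Otimes>\<^sub>M M) (\<Pi>\<^sub>M i\<in>I. borel) (\<lambda>p. \<lambda>i\<in>I. ?Y i p)) (Pi\<^sub>E I A) =
      emeasure (distr M (\<Pi>\<^sub>M i\<in>I. borel) (\<lambda>w. \<lambda>i\<in>I. X i w)) (Pi\<^sub>E I A)" .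
  next
    interpret L: prob_space "distr (M \<Otimes>\<^sub>M M) (\<Pi>\<^sub>M i\<in>I. borel) (\<lambda>p. \<lambda>i\<in>I. ?Y i p)"
      by (intro MM.prob_space_distr measurable_restrict) auto
    show "range (\<lambda>n::nat. Pi\<^sub>E I (\<lambda>_. UNIV)) \<subseteq> prod_algebra I (\<lambda>_. borel :: real measure)"
      using I by (auto intro!: prod_algebraI_finite)
    show "(\<Union>i::nat. Pi\<^sub>E I (\<lambda>_. UNIV)) = space (\<Pi>\<^sub>M i\<in>I. borel :: real measure)"
      by (simp add: space_PiM)
    show "emeasure (distr (M \<Otimes>\<^sub>M M) (\<Pi>\<^sub>M i\<in>I. borel) (\<lambda>p. \<lambda>i\<in>I. ?Y i p)) (Pi\<^sub>E I (\<lambda>_. UNIV)) \<noteq> \<infinity>"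
      by simp
  qed auto
qed

text \<open>Equality of the joint laws of the increments transfers to any event about partial sums:
  a walk stays near 0 as likely as two independent copies stay near each other. The latter can be
  bounded below with no knowledge of the path law.\<close>

lemma (in prob_space) emeasure_symmetrized_gaussian_walk:
  fixes X :: "nat \<Rightarrow> 'a \<Rightarrow> real"
  assumes k: "0 < k" and indep: "indep_vars (\<lambda>_. borel) X {..<k}"
    and \<sigma>: "\<And>i. i < k \<Longrightarrow> 0 < \<sigma> i"
    and X: "\<And>i. i < k \<Longrightarrow> distributed M lborel (X i) (normal_density 0 (\<sigma> i))"
  shows "emeasure (M \<Otimes>\<^sub>M M) {p \<in> space (M \<Otimes>\<^sub>M M). \<forall>j\<le>k. \<bar>(\<Sum>i<j. X i (fst p)) - (\<Sum>i<j. X i (snd p))\<bar> \<le> sqrt 2 * \<epsilon>} =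
    emeasure M {w \<in> space M. \<forall>j\<le>k. \<bar>\<Sum>i<j. X i w\<bar> \<le> \<epsilon>}"
proof -
  have Xm [measurable]: "X i \<in> borel_measurable M" if "i < k" for i
    using indep that by (auto simp: indep_vars_def)
  let ?N = "\<Pi>\<^sub>M i\<in>{..<k}. borel :: real measure"
  let ?Y = "\<lambda>p. \<lambda>i\<in>{..<k}. (X i (fst p) - X i (snd p)) / sqrt 2"
  \<comment> \<open>The tube event as a set of increment vectors, so that both probabilities are
    measures of \<open>S\<close> under the same law.\<close>
  define S where "S = {x \<in> space ?N. \<forall>j\<le>k. \<bar>\<Sum>i<j. x i\<bar> \<le> \<epsilon>}"
  have S: "S \<in> sets ?N"
  proof -
    have [measurable]: "(\<lambda>x. \<Sum>i<j. x i) \<in> borel_measurable ?N" if "j \<le> k" for j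
      using that by (intro borel_measurable_sum measurable_component_singleton) auto
    have "S = space ?N \<inter> (\<Inter>j\<in>{..k}. {x \<in> space ?N. \<bar>\<Sum>i<j. x i\<bar> \<le> \<epsilon>})"
      by (auto simp: S_def)
    also have "\<dots> \<in> sets ?N"
      by (intro sets.Int sets.top sets.finite_INT) auto
    finally show ?thesis .
  qed
  have "emeasure (distr (M \<Otimes>\<^sub>M M) ?N ?Y) S = emeasure (distr M ?N (\<lambda>w. \<lambda>i\<in>{..<k}. X i w)) S"
    using k by (subst distr_symmetrized_normal_vector[OF _ _ indep \<sigma> X]) auto
  moreover have "emeasure (distr (M \<Otimes>\<^sub>M M) ?N ?Y) S =
      emeasure (M \<Otimes>\<^sub>M M) (?Y -` S \<inter> space (M \<Otimes>\<^sub>M M))"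
    using S by (intro emeasure_distr) (auto intro!: measurable_restrict)
  moreover have "emeasure (distr M ?N (\<lambda>w. \<lambda>i\<in>{..<k}. X i w)) S =
      emeasure M ((\<lambda>w. \<lambda>i\<in>{..<k}. X i w) -` S \<inter> space M)"
    using S by (intro emeasure_distr) (auto intro!: measurable_restrict)
  moreover have "?Y -` S \<inter> space (M \<Otimes>\<^sub>M M) = {p \<in> space (M \<Otimes>\<^sub>M M). \<forall>j\<le>k. \<bar>(\<Sum>i<j. X i (fst p)) - (\<Sum>i<j. X i (snd p))\<bar> \<le> sqrt 2 * \<epsilon>}"
  proof -
    have "\<bar>\<Sum>i<j. ?Y p i\<bar> \<le> \<epsilon> \<longleftrightarrow> \<bar>(\<Sum>i<j. X i (fst p)) - (\<Sum>i<j. X i (snd p))\<bar> \<le> sqrt 2 * \<epsilon>" if "j \<le> k" for j p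
    proof -
      have "(\<Sum>i<j. ?Y p i) = (\<Sum>i<j. (X i (fst p) - X i (snd p)) / sqrt 2)"
        using that by (intro sum.cong) auto
      also have "\<dots> = ((\<Sum>i<j. X i (fst p)) - (\<Sum>i<j. X i (snd p))) / sqrt 2"
        by (simp add: sum_subtractf flip: sum_divide_distrib)
      finally show ?thesis by (simp only: abs_divide) (simp add: pos_divide_le_eq mult.commute)
    qed
    then show ?thesis by (auto simp: S_def space_PiM)
  qed
  moreover have "(\<lambda>w. \<lambda>i\<in>{..<k}. X i w) -` S \<inter> space M = {w \<in> space M. \<forall>j\<le>k. \<bar>\<Sum>i<j. X i w\<bar> \<le> \<epsilon>}"
  proof -
    have "(\<Sum>i<j. (\<lambda>i\<in>{..<k}. X i w) i) = (\<Sum>i<j. X i w)" if "j \<le> k" for j w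
      using that by (intro sum.cong) auto
    then show ?thesis by (auto simp: S_def space_PiM)
  qed
  ultimately show ?thesis by simp
qed

text \<open>Separability of path space in usable form: a number and an integer list range over a
  countable type. One \<open>\<delta>\<close> of the error comes from uniform continuity, the other
  from rounding the value down to a multiple of \<open>\<delta>\<close>.\<close>

lemma continuous_near_integer_step_function:
  fixes f :: "real \<Rightarrow> real"
  assumes f: "continuous_on {0..T} f" and \<delta>: "0 < \<delta>"
  shows "\<exists>(N::nat) (ks::int list). \<forall>s\<in>{0..T}. \<bar>f s - \<delta> * of_int (ks ! nat \<lfloor>s * N\<rfloor>)\<bar> \<le> 2 * \<delta>"
proof -
  have "uniformly_continuous_on {0..T} f"
    by (intro compact_uniformly_continuous f) auto
  then obtain \<eta> where \<eta>: "0 < \<eta>"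
    "\<And>s s'. s \<in> {0..T} \<Longrightarrow> s' \<in> {0..T} \<Longrightarrow> dist s' s < \<eta> \<Longrightarrow> dist (f s') (f s) < \<delta>"
    using \<delta> unfolding uniformly_continuous_on_def by metis
  obtain n where n: "inverse (real (Suc n)) < \<eta>" using \<eta>(1) reals_Archimedean by blast
  define N where "N = Suc n"
  \<comment> \<open>The list needs one entry more than the last full index, since at
    \<open>s = T\<close> the index is \<open>nat \<lfloor>T * N\<rfloor>\<close> itself.\<close>
  define ks where "ks = map (\<lambda>j. \<lfloor>f (real j / N) / \<delta>\<rfloor>) [0..<Suc (nat \<lfloor>T * N\<rfloor>)]"
  have "\<bar>f s - \<delta> * of_int (ks ! nat \<lfloor>s * N\<rfloor>)\<bar> \<le> 2 * \<delta>" if s: "s \<in> {0..T}" for s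
  proof -
    define j where "j = nat \<lfloor>s * N\<rfloor>"
    have j: "real j \<le> s * N" "s * N < real j + 1"
      using s by (auto simp: j_def)
    have "j \<le> nat \<lfloor>T * N\<rfloor>"
      unfolding j_def using s by (intro nat_mono floor_mono mult_right_mono) auto
    then have ks: "ks ! j = \<lfloor>f (real j / N) / \<delta>\<rfloor>"
      unfolding ks_def by (subst nth_map) (auto simp del: upt_Suc)
    have jN: "real j / N \<le> s" "s < real j / N + inverse N"
      using j by (auto simp: N_def field_simps)
    then have "dist (real j / N) s < \<eta>" using n by (auto simp: dist_real_def N_def)
    then have 1: "\<bar>f (real j / N) - f s\<bar> < \<delta>"
      using \<eta>(2)[of s "real j / N"] s jN by (auto simp: dist_real_def N_def)
    have "\<delta> * of_int (ks ! j) \<le> f (real j / N)" "f (real j / N) < \<delta> * (of_int (ks ! j) + 1)"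
      using floor_correct[of "f (real j / N) / \<delta>"]
      unfolding ks pos_le_divide_eq[OF \<delta>] pos_divide_less_eq[OF \<delta>] by (simp_all add: mult.commute)
    with 1 show ?thesis unfolding j_def[symmetric] by (auto simp: algebra_simps abs_if split: if_splits)
  qed
  then show ?thesis by blast
qed

text \<open>The support of the law of \<open>B\<close> is nonempty because the path space is separable, so two
  independent copies of \<open>B\<close> are close with positive probability; their difference divided by
  \<open>sqrt 2\<close> is again a Brownian motion.\<close>

lemma brownian_small_ball:
  assumes M: "prob_space M" and B: "brownian_motion M B" and T: "0 < T" and \<epsilon>: "0 < \<epsilon>"
  shows "0 < measure M {w \<in> space M. \<forall>n. \<forall>j\<le>2 ^ n. \<bar>B (T * real j / 2 ^ n) w\<bar> \<le> \<epsilon>}"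
proof -
  interpret prob_space M by fact
  interpret MM: pair_prob_space M M ..
  have Bm [measurable]: "B t \<in> borel_measurable M" if "0 \<le> t" for t
    using B that by (auto simp: brownian_motion_def)
  have Bm' [measurable]: "B (T * real j / 2 ^ n) \<in> borel_measurable M" for j n
    using T by auto
  \<comment> \<open>Two paths near the same step function differ by at most
    \<open>4 * \<delta>\<close>, their displacements from time 0 by at most
    \<open>8 * \<delta>\<close>, which is \<open>sqrt 2 * \<epsilon>\<close>.\<close>
  define \<delta> where "\<delta> = sqrt 2 * \<epsilon> / 8"
  have \<delta>: "0 < \<delta>" using \<epsilon> by (simp add: \<delta>_def)
  \<comment> \<open>Only dyadic times are tested, which makes the event a countable intersection and
    hence measurable.\<close>
  define C where "C N ks = {w \<in> space M. \<forall>n. \<forall>j\<le>2 ^ n. \<bar>B (T * real j / 2 ^ n) w -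
      \<delta> * of_int (ks ! nat \<lfloor>(T * real j / 2 ^ n) * real N\<rfloor>)\<bar> \<le> 2 * \<delta>}" for N :: nat and ks :: "int list"
  have C [measurable]: "C N ks \<in> sets M" for N ks
    unfolding C_def by measurable
  have grid: "T * real j / 2 ^ n \<in> {0..T}" if "j \<le> 2 ^ n" for j n :: nat
    using T that by (auto simp: divide_le_eq simp flip: of_nat_le_iff)
  \<comment> \<open>Countably many sets \<open>C N ks\<close> cover almost every outcome, so they
    cannot all be null.\<close>
  obtain N ks where pos: "0 < emeasure M (C N ks)"
  proof (rule ccontr)
    assume "\<not> thesis"
    then have "emeasure M (C N ks) = 0" for N ks
      using that[of N ks] by (auto simp: zero_less_iff_neq_zero)
    then have "AE w in M. w \<notin> C N ks" for N ks
      using AE_not_in[of "C N ks" M] C by (auto simp: null_sets_def)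
    then have "AE w in M. \<forall>N ks. w \<notin> C N ks"
      by (simp add: AE_all_countable)
    moreover have "AE w in M. continuous_on {0..} (\<lambda>t. B t w)"
      using B by (auto simp: brownian_motion_def)
    ultimately have "AE w in M. False"
      using AE_space
    proof eventually_elim
      case (elim w)
      have "continuous_on {0..T} (\<lambda>t. B t w)"
        by (rule continuous_on_subset[OF elim(2)]) auto
      from continuous_near_integer_step_function[OF this \<delta>] obtain N ks where
        "\<And>s. s \<in> {0..T} \<Longrightarrow> \<bar>B s w - \<delta> * of_int (ks ! nat \<lfloor>s * real N\<rfloor>)\<bar> \<le> 2 * \<delta>" by blast
      then have "w \<in> C N ks" using grid elim(3) unfolding C_def by blast
      with elim(1) show False by blast
    qed
    then show False by simp
  qed
  define a where "a = measure M (C N ks)"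
  have a: "0 < a" using pos by (simp add: a_def emeasure_eq_measure)
  \<comment> \<open>Displacements from \<open>B 0\<close> are used because partial sums of
    increments produce them; \<open>B 0\<close> vanishes only almost surely and is removed at the
    end.\<close>
  define G where "G n = {w \<in> space M. \<forall>j\<le>2 ^ n. \<bar>B (T * real j / 2 ^ n) w - B 0 w\<bar> \<le> \<epsilon>}" for n :: nat
  have G [measurable]: "G n \<in> sets M" for n
    unfolding G_def by measurable
  \<comment> \<open>The bound does not depend on \<open>n\<close>, because \<open>C N ks\<close>
    controls all dyadic levels at once; hence it survives the limit along the decreasing sequence
    \<open>G\<close>.\<close>
  have le: "a\<^sup>2 \<le> measure M (G n)" for n
  proof -
    define \<tau> where "\<tau> j = T * real j / 2 ^ n" for j
    define X where "X j w = B (\<tau> (Suc j)) w - B (\<tau> j) w" for j w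
    have \<tau>: "0 \<le> \<tau> j" "\<tau> j < \<tau> (Suc j)" "mono \<tau>" "\<tau> 0 = 0" for j
      using T by (auto simp: \<tau>_def mono_def field_simps)
    have sumX: "(\<Sum>i<j. X i w) = B (\<tau> j) w - B 0 w" for j w
      unfolding X_def using sum_lessThan_telescope[of "\<lambda>i. B (\<tau> i) w" j] \<tau>(4) by simp
    have "indep_vars (\<lambda>_. borel) X {..<2 ^ n}"
      using B \<tau> unfolding brownian_motion_def X_def[abs_def] by blast
    moreover have "distributed M lborel (X i) (normal_density 0 (sqrt (\<tau> (Suc i) - \<tau> i)))" for i
      using B \<tau>(1,2)[of i] unfolding brownian_motion_def X_def[abs_def] by blast
    ultimately have "emeasure (M \<Otimes>\<^sub>M M) {p \<in> space (M \<Otimes>\<^sub>M M). \<forall>j\<le>2 ^ n.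
        \<bar>(\<Sum>i<j. X i (fst p)) - (\<Sum>i<j. X i (snd p))\<bar> \<le> sqrt 2 * \<epsilon>} =
      emeasure M {w \<in> space M. \<forall>j\<le>2 ^ n. \<bar>\<Sum>i<j. X i w\<bar> \<le> \<epsilon>}"
      using \<tau> by (intro emeasure_symmetrized_gaussian_walk) auto
    then have eq: "emeasure M (G n) = emeasure (M \<Otimes>\<^sub>M M) {p \<in> space (M \<Otimes>\<^sub>M M). \<forall>j\<le>2 ^ n.
        \<bar>(B (\<tau> j) (fst p) - B 0 (fst p)) - (B (\<tau> j) (snd p) - B 0 (snd p))\<bar> \<le> sqrt 2 * \<epsilon>}"
      unfolding G_def sumX \<tau>_def by simp
    have "emeasure (M \<Otimes>\<^sub>M M) (C N ks \<times> C N ks) \<le> emeasure M (G n)"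
      unfolding eq
    proof (rule emeasure_mono)
      have [measurable]: "B (\<tau> j) \<in> borel_measurable M" for j using \<tau> by auto
      show "{p \<in> space (M \<Otimes>\<^sub>M M). \<forall>j\<le>2 ^ n.
        \<bar>(B (\<tau> j) (fst p) - B 0 (fst p)) - (B (\<tau> j) (snd p) - B 0 (snd p))\<bar> \<le> sqrt 2 * \<epsilon>} \<in> sets (M \<Otimes>\<^sub>M M)"
        by measurable
      have d: "\<bar>B (\<tau> j) w - B (\<tau> j) w'\<bar> \<le> 4 * \<delta>" if "w \<in> C N ks" "w' \<in> C N ks" "j \<le> 2 ^ n" for w w' j
      proof -
        define c where "c = \<delta> * of_int (ks ! nat \<lfloor>\<tau> j * real N\<rfloor>)"
        have "\<bar>B (\<tau> j) w - c\<bar> \<le> 2 * \<delta>" "\<bar>B (\<tau> j) w' - c\<bar> \<le> 2 * \<delta>"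
          using that by (auto simp: C_def \<tau>_def c_def)
        then show ?thesis by linarith
      qed
      show "C N ks \<times> C N ks \<subseteq> {p \<in> space (M \<Otimes>\<^sub>M M). \<forall>j\<le>2 ^ n.
        \<bar>(B (\<tau> j) (fst p) - B 0 (fst p)) - (B (\<tau> j) (snd p) - B 0 (snd p))\<bar> \<le> sqrt 2 * \<epsilon>}"
      proof safe
        fix w w' j assume w: "w \<in> C N ks" "w' \<in> C N ks" and "j \<le> (2::nat) ^ n"
        then have "\<bar>B (\<tau> j) w - B (\<tau> j) w'\<bar> \<le> 4 * \<delta>" "\<bar>B 0 w - B 0 w'\<bar> \<le> 4 * \<delta>"
          using d[of w w' j] d[of w w' 0] \<tau>(4) by auto
        then show "\<bar>(B (\<tau> j) (fst (w, w')) - B 0 (fst (w, w'))) - (B (\<tau> j) (snd (w, w')) - B 0 (snd (w, w')))\<bar> \<le> sqrt 2 * \<epsilon>"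
          unfolding fst_conv snd_conv \<delta>_def by linarith
      qed (auto simp: space_pair_measure C_def)
    qed
    moreover have "emeasure (M \<Otimes>\<^sub>M M) (C N ks \<times> C N ks) = ennreal (a\<^sup>2)"
      by (simp add: emeasure_pair_measure_Times emeasure_eq_measure a_def power2_eq_square ennreal_mult)
    ultimately show ?thesis by (simp add: emeasure_eq_measure)
  qed
  have dec: "decseq G"
  proof (rule decseq_SucI)
    fix n show "G (Suc n) \<subseteq> G n"
    proof
      fix w assume w: "w \<in> G (Suc n)"
      have "\<bar>B (T * real j / 2 ^ n) w - B 0 w\<bar> \<le> \<epsilon>" if "j \<le> 2 ^ n" for j
      proof -
        have "2 * j \<le> 2 ^ Suc n" using that by simp
        then have "\<bar>B (T * real (2 * j) / 2 ^ Suc n) w - B 0 w\<bar> \<le> \<epsilon>"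
          using w unfolding G_def by blast
        then show ?thesis by simp
      qed
      then show "w \<in> G n" using w by (auto simp: G_def)
    qed
  qed
  have "(\<lambda>n. measure M (G n)) \<longlonglongrightarrow> measure M (\<Inter>n. G n)"
    using dec G by (intro finite_Lim_measure_decseq) auto
  then have "a\<^sup>2 \<le> measure M (\<Inter>n. G n)"
    by (rule LIMSEQ_le_const) (use le in auto)
  also have "measure M (\<Inter>n. G n) \<le> measure M {w \<in> space M. \<forall>n. \<forall>j\<le>2 ^ n. \<bar>B (T * real j / 2 ^ n) w\<bar> \<le> \<epsilon>}"
  proof (rule finite_measure_mono_AE)
    have "AE w in M. B 0 w = 0" using B by (auto simp: brownian_motion_def)
    then show "AE w in M. w \<in> (\<Inter>n. G n) \<longrightarrow> w \<in> {w \<in> space M. \<forall>n. \<forall>j\<le>2 ^ n. \<bar>B (T * real j / 2 ^ n) w\<bar> \<le> \<epsilon>}"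
      by eventually_elim (auto simp: G_def)
  qed measurable
  finally show ?thesis using a by (smt (verit) zero_less_power)
qed

text \<open>Independence is given for whole paths in the product sigma-algebra. The small-ball event
  depends on countably many times, so it is measurable there and its probabilities multiply.\<close>

lemma independent_brownian_small_ball:
  assumes M: "prob_space M" and B: "independent_brownian_motions M I B" and I: "finite I"
    and T: "0 < T" and \<epsilon>: "0 < \<epsilon>"
  shows "0 < measure M {w \<in> space M. \<forall>i\<in>I. \<forall>n. \<forall>j\<le>2 ^ n. \<bar>B i (T * real j / 2 ^ n) w\<bar> \<le> \<epsilon>}"
proof (cases "I = {}")
  case True
  then show ?thesis using prob_space.prob_space[OF M] by simp
next
  case False
  interpret prob_space M by fact
  let ?P = "Pi\<^sub>M {0..} (\<lambda>_. borel) :: (real \<Rightarrow> real) measure"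
  define A where "A = {f \<in> space ?P. \<forall>n. \<forall>j\<le>2 ^ n. \<bar>f (T * real j / 2 ^ n)\<bar> \<le> \<epsilon>}"
  have [measurable]: "(\<lambda>f. f (T * real j / 2 ^ n)) \<in> borel_measurable ?P" for j n
    using T by (intro measurable_component_singleton) auto
  have A: "A \<in> sets ?P" unfolding A_def by measurable
  have eq: "(\<lambda>w. \<lambda>t\<in>{0..}. B i t w) -` A \<inter> space M =
      {w \<in> space M. \<forall>n. \<forall>j\<le>2 ^ n. \<bar>B i (T * real j / 2 ^ n) w\<bar> \<le> \<epsilon>}" for i
    using T by (auto simp: A_def space_PiM)
  have "prob (\<Inter>i\<in>I. (\<lambda>w. \<lambda>t\<in>{0..}. B i t w) -` A \<inter> space M) =
      (\<Prod>i\<in>I. prob ((\<lambda>w. \<lambda>t\<in>{0..}. B i t w) -` A \<inter> space M))"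
    using B A False I unfolding independent_brownian_motions_def
    by (intro indep_varsD_finite[where M' = "\<lambda>_. ?P"]) auto
  also have "\<dots> > 0"
    unfolding eq using B T \<epsilon> M
    by (intro prod_pos brownian_small_ball) (auto simp: independent_brownian_motions_def)
  also have "(\<Inter>i\<in>I. (\<lambda>w. \<lambda>t\<in>{0..}. B i t w) -` A \<inter> space M) =
      {w \<in> space M. \<forall>i\<in>I. \<forall>n. \<forall>j\<le>2 ^ n. \<bar>B i (T * real j / 2 ^ n) w\<bar> \<le> \<epsilon>}"
    unfolding eq using False by auto
  finally show ?thesis .
qed

section \<open>Invariant measures of Feller kernels\<close>

text \<open>The integral is additive in the measure. The additive form lets differences of measures
  be handled in extended nonnegative reals without subtraction.\<close>

lemma nn_integral_add_measure:
  assumes sets [measurable_cong]: "sets M1 = sets M3" "sets M2 = sets M3"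
    and eq: "\<And>A. A \<in> sets M3 \<Longrightarrow> emeasure M1 A + emeasure M2 A = emeasure M3 A"
    and f: "f \<in> borel_measurable M3"
  shows "(\<integral>\<^sup>+x. f x \<partial>M1) + (\<integral>\<^sup>+x. f x \<partial>M2) = (\<integral>\<^sup>+x. f x \<partial>M3)"
  using f
proof (induction rule: borel_measurable_induct)
  case (cong f g)
  have sp: "space M1 = space M3" "space M2 = space M3" using sets by (auto dest: sets_eq_imp_space_eq)
  have "integral\<^sup>N M1 f = integral\<^sup>N M1 g" "integral\<^sup>N M2 f = integral\<^sup>N M2 g" "integral\<^sup>N M3 f = integral\<^sup>N M3 g"
    using cong(3) sp by (auto intro!: nn_integral_cong)
  with cong(4) show ?case by simp
next
  case (set A)
  then show ?case using eq sets by simp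
next
  case (mult u c)
  have [measurable]: "u \<in> borel_measurable M3" by fact
  show ?case using mult.IH by (simp add: nn_integral_cmult flip: distrib_left)
next
  case (add u v)
  have [measurable]: "u \<in> borel_measurable M3" "v \<in> borel_measurable M3" by fact+
  show ?case using add.IH by (simp add: nn_integral_add ac_simps)
next
  case (seq U)
  have [measurable]: "U i \<in> borel_measurable M3" for i by fact
  have mono: "incseq (\<lambda>i. integral\<^sup>N N (U i))" for N
    using seq(3) by (auto simp: incseq_def le_fun_def intro!: nn_integral_mono)
  have "(\<integral>\<^sup>+x. (SUP i. U i x) \<partial>N) = (SUP i. integral\<^sup>N N (U i))" if "sets N = sets M3" for N
    by (rule nn_integral_monotone_convergence_SUP[OF seq(3)]) (simp add: that cong: measurable_cong_sets)
  then show ?case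
    using sets seq.IH ennreal_SUP_add[OF mono mono, of M1 M2] by (simp add: image_comp SUP_apply)
qed

text \<open>Finite instead of probability, so that the Jordan parts qualify without
  normalization.\<close>

definition invariant_measure :: "(real \<Rightarrow> 'a::topological_space \<Rightarrow> 'a measure) \<Rightarrow> 'a measure \<Rightarrow> bool" where
  "invariant_measure P \<mu> \<longleftrightarrow> finite_measure \<mu> \<and> sets \<mu> = sets borel \<and>
     (\<forall>t\<ge>0. \<forall>A\<in>sets borel. (\<integral>\<^sup>+ z. emeasure (P t z) A \<partial>\<mu>) = emeasure \<mu> A)"

text \<open>The condition \<open>lsc\<close> is weak continuity of the kernels, tested on open sets
  as in the portmanteau theorem. It also yields their measurability.\<close>

locale feller_kernels =
  fixes P :: "real \<Rightarrow> 'a::{metric_space, second_countable_topology} \<Rightarrow> 'a measure"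
  assumes prob: "0 \<le> t \<Longrightarrow> prob_space (P t z)"
    and sets_P: "0 \<le> t \<Longrightarrow> sets (P t z) = sets borel"
    and lsc: "0 \<le> t \<Longrightarrow> open U \<Longrightarrow> \<zeta> \<longlonglongrightarrow> z \<Longrightarrow>
      emeasure (P t z) U \<le> liminf (\<lambda>k. emeasure (P t (\<zeta> k)) U)"
begin

lemma open_emeasure_greater:
  assumes t: "0 \<le> t" and U: "open U"
  shows "open {z. a < emeasure (P t z) U}"
proof -
  have "closed {z. emeasure (P t z) U \<le> a}"
    unfolding closed_sequential_limits
  proof (safe)
    fix \<zeta> z assume \<zeta>: "\<forall>n. \<zeta> n \<in> {z. emeasure (P t z) U \<le> a}" "\<zeta> \<longlonglongrightarrow> z"
    have "emeasure (P t z) U \<le> liminf (\<lambda>k. emeasure (P t (\<zeta> k)) U)"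
      using t U \<zeta> by (intro lsc)
    also have "\<dots> \<le> liminf (\<lambda>k. a)" using \<zeta> by (intro Liminf_mono) auto
    finally show "emeasure (P t z) U \<le> a" by (simp add: Liminf_const)
  qed
  moreover have "{z. a < emeasure (P t z) U} = - {z. emeasure (P t z) U \<le> a}" by auto
  ultimately show ?thesis by (simp add: open_Compl)
qed

text \<open>On open sets the kernel is lower semicontinuous in the starting point, hence measurable,
  and open sets are an intersection-stable generator.\<close>

lemma measurable_kernel: "0 \<le> t \<Longrightarrow> P t \<in> borel \<rightarrow>\<^sub>M subprob_algebra borel"
proof (rule measurable_subprob_algebra_generated[where G = "Collect open" and \<Omega> = UNIV])
  assume t: "0 \<le> t"
  show "sets borel = sigma_sets UNIV (Collect (open :: 'a set \<Rightarrow> bool))"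
    by (simp add: borel_def)
  show "Int_stable (Collect (open :: 'a set \<Rightarrow> bool))" by (auto simp: Int_stable_def)
  have *: "(\<lambda>z. emeasure (P t z) U) \<in> borel_measurable borel" if "open U" for U
    using open_emeasure_greater[OF t that] by (intro borel_measurableI_greater) simp
  show "(\<lambda>z. emeasure (P t z) U) \<in> borel_measurable borel" if "U \<in> Collect open" for U
    using that * by simp
  show "(\<lambda>z. emeasure (P t z) UNIV) \<in> borel_measurable borel" by (rule *) simp
qed (auto simp: prob sets_P prob_space_imp_subprob_space)

lemma measurable_emeasure_kernel [measurable]:
  "0 \<le> t \<Longrightarrow> A \<in> sets borel \<Longrightarrow> (\<lambda>z. emeasure (P t z) A) \<in> borel_measurable borel"
  using measurable_kernel by (rule measurable_emeasure_kernel)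

lemma emeasure_kernel_UNIV: "0 \<le> t \<Longrightarrow> emeasure (P t z) UNIV = 1"
  using prob_space.emeasure_space_1[OF prob] sets_eq_imp_space_eq[OF sets_P] by simp

lemma nn_integral_invariant_measure:
  assumes \<mu>: "invariant_measure P \<mu>" and t: "0 \<le> t" and f: "f \<in> borel_measurable borel"
  shows "(\<integral>\<^sup>+z. (\<integral>\<^sup>+x. f x \<partial>P t z) \<partial>\<mu>) = (\<integral>\<^sup>+z. f z \<partial>\<mu>)"
proof -
  have sets [measurable_cong]: "sets \<mu> = sets borel" using \<mu> by (simp add: invariant_measure_def)
  then have sp: "space \<mu> = UNIV" using sets_eq_imp_space_eq by fastforce
  have K: "P t \<in> \<mu> \<rightarrow>\<^sub>M subprob_algebra borel"
    using measurable_kernel[OF t] by (simp add: measurable_cong_sets[OF sets refl])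
  have "\<mu> \<bind> P t = \<mu>"
  proof (rule measure_eqI)
    show s: "sets (\<mu> \<bind> P t) = sets \<mu>" using sp sets_P[OF t] sets by (subst sets_bind[of _ _ borel]) auto
    fix A assume "A \<in> sets (\<mu> \<bind> P t)"
    then have "A \<in> sets borel" using s sets by simp
    then show "emeasure (\<mu> \<bind> P t) A = emeasure \<mu> A"
      using \<mu> t sp by (subst emeasure_bind[OF _ K]) (auto simp: invariant_measure_def)
  qed
  then show ?thesis using nn_integral_bind[OF f K] by simp
qed

text \<open>\<open>Y\<close> is a positive set of a Hahn decomposition and \<open>\<rho>\<close> the
  positive part of \<open>\<mu>\<close> minus \<open>\<nu>\<close>. One step of the kernel can only
  increase \<open>\<rho>\<close> on each set, since the negative part was subtracted from something
  larger; conservation of mass turns the inequality into equality.\<close>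

lemma invariant_positive_part:
  assumes \<mu>: "invariant_measure P \<mu>" and \<nu>: "invariant_measure P \<nu>" and Y [measurable]: "Y \<in> sets borel"
    and pos: "\<And>X. X \<in> sets borel \<Longrightarrow> X \<subseteq> Y \<Longrightarrow> emeasure \<nu> X \<le> emeasure \<mu> X"
    and neg: "\<And>X. X \<in> sets borel \<Longrightarrow> X \<inter> Y = {} \<Longrightarrow> emeasure \<mu> X \<le> emeasure \<nu> X"
  obtains \<rho> where "invariant_measure P \<rho>"
    "\<And>A. A \<in> sets borel \<Longrightarrow> emeasure \<rho> A = emeasure \<mu> (A \<inter> Y) - emeasure \<nu> (A \<inter> Y)"
proof -
  have s [measurable_cong, simp]: "sets \<mu> = sets borel" "sets \<nu> = sets borel" using \<mu> \<nu> by (auto simp: invariant_measure_def)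
  have sp [simp]: "space \<mu> = UNIV" "space \<nu> = UNIV" using s[THEN sets_eq_imp_space_eq] by auto
  interpret \<mu>: finite_measure \<mu> using \<mu> by (simp add: invariant_measure_def)
  interpret \<nu>: finite_measure \<nu> using \<nu> by (simp add: invariant_measure_def)
  define \<mu>Y where "\<mu>Y = density \<mu> (indicator Y)"
  define \<nu>Y where "\<nu>Y = density \<nu> (indicator Y)"
  define \<rho> where "\<rho> = diff_measure \<mu>Y \<nu>Y"
  have \<mu>Y: "emeasure \<mu>Y A = emeasure \<mu> (A \<inter> Y)" "emeasure \<nu>Y A = emeasure \<nu> (A \<inter> Y)" if [measurable]: "A \<in> sets borel" for A
    by (simp_all add: \<mu>Y_def \<nu>Y_def emeasure_density flip: indicator_inter_arith) (simp_all add: Int_commute)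
  have sY [simp, measurable_cong]: "sets \<mu>Y = sets borel" "sets \<nu>Y = sets borel" "sets \<rho> = sets borel"
    by (simp_all add: \<mu>Y_def \<nu>Y_def \<rho>_def)
  have spY [simp]: "space \<mu>Y = UNIV" "space \<nu>Y = UNIV" "space \<rho> = UNIV"
    by (simp_all add: \<mu>Y_def \<nu>Y_def \<rho>_def)
  have fin: "finite_measure \<mu>Y" "finite_measure \<nu>Y"
    using \<mu>Y[of UNIV] by (auto intro!: finite_measureI)
  have \<rho>: "emeasure \<rho> A = emeasure \<mu> (A \<inter> Y) - emeasure \<nu> (A \<inter> Y)" if "A \<in> sets borel" for A
    unfolding \<rho>_def using fin that \<mu>Y pos by (subst emeasure_diff_measure) auto
  have \<rho>fin: "finite_measure \<rho>"
    using \<rho>[of UNIV] by (intro finite_measureI) simp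
  have step: "emeasure \<rho> A \<le> (\<integral>\<^sup>+z. emeasure (P t z) A \<partial>\<rho>)" if t: "0 \<le> t" and A [measurable]: "A \<in> sets borel" and AY: "A \<subseteq> Y" for t A
  proof -
    let ?f = "\<lambda>z. emeasure (P t z) A"
    have [measurable]: "?f \<in> borel_measurable borel" using t A by (rule measurable_emeasure_kernel)
    have 1: "(\<integral>\<^sup>+z. ?f z \<partial>\<rho>) + (\<integral>\<^sup>+z. ?f z \<partial>\<nu>Y) = (\<integral>\<^sup>+z. ?f z \<partial>\<mu>Y)"
    proof (rule nn_integral_add_measure)
      fix B assume "B \<in> sets \<mu>Y"
      then show "emeasure \<rho> B + emeasure \<nu>Y B = emeasure \<mu>Y B"
        using pos[of "B \<inter> Y"] by (simp add: \<rho> \<mu>Y diff_add_cancel_ennreal)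
    qed auto
    \<comment> \<open>The restrictions off \<open>Y\<close>, where \<open>\<nu>\<close> dominates:
      their contribution to the invariance equations has the favourable sign and is dropped in
      \<open>3\<close>.\<close>
    define \<mu>N where "\<mu>N = density \<mu> (indicator (- Y))"
    define \<nu>N where "\<nu>N = density \<nu> (indicator (- Y))"
    have \<mu>N: "emeasure \<mu>N A = emeasure \<mu> (A - Y)" "emeasure \<nu>N A = emeasure \<nu> (A - Y)" if [measurable]: "A \<in> sets borel" for A
      by (simp_all add: \<mu>N_def \<nu>N_def emeasure_density flip: indicator_inter_arith) (simp_all add: Int_commute Diff_eq)
    have sN: "sets \<mu>N = sets borel" "sets \<nu>N = sets borel" by (simp_all add: \<mu>N_def \<nu>N_def)
    have dec: "emeasure \<mu>Y B + emeasure \<mu>N B = emeasure \<mu> B" "emeasure \<nu>Y B + emeasure \<nu>N B = emeasure \<nu> B" if "B \<in> sets borel" for B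
      using that by (auto simp: \<mu>Y \<mu>N plus_emeasure Int_Diff_disjoint Int_Diff_Un)
    have 2: "(\<integral>\<^sup>+z. ?f z \<partial>\<mu>Y) + (\<integral>\<^sup>+z. ?f z \<partial>\<mu>N) = (\<integral>\<^sup>+z. ?f z \<partial>\<mu>)"
      "(\<integral>\<^sup>+z. ?f z \<partial>\<nu>Y) + (\<integral>\<^sup>+z. ?f z \<partial>\<nu>N) = (\<integral>\<^sup>+z. ?f z \<partial>\<nu>)"
      by (rule nn_integral_add_measure; use dec sN in simp)+
    have 3: "(\<integral>\<^sup>+z. ?f z \<partial>\<mu>N) \<le> (\<integral>\<^sup>+z. ?f z \<partial>\<nu>N)"
      using neg by (intro nn_integral_mono_measure) (auto simp: sN le_measure \<mu>N intro!: neg)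
    have "emeasure \<mu> A = (\<integral>\<^sup>+z. ?f z \<partial>\<mu>Y) + (\<integral>\<^sup>+z. ?f z \<partial>\<mu>N)"
      using \<mu> t A unfolding 2 by (simp add: invariant_measure_def)
    also have "\<dots> \<le> ((\<integral>\<^sup>+z. ?f z \<partial>\<rho>) + (\<integral>\<^sup>+z. ?f z \<partial>\<nu>Y)) + (\<integral>\<^sup>+z. ?f z \<partial>\<nu>N)"
      unfolding 1 using 3 by (intro add_left_mono)
    also have "\<dots> = (\<integral>\<^sup>+z. ?f z \<partial>\<rho>) + emeasure \<nu> A"
      using \<nu> t A 2 by (simp add: invariant_measure_def add.assoc)
    finally have "emeasure \<mu> A - emeasure \<nu> A \<le> (\<integral>\<^sup>+z. ?f z \<partial>\<rho>)"
      by (simp add: ennreal_minus_le_iff add.commute)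
    then show ?thesis using AY A by (simp add: \<rho> Int_absorb2)
  qed
  \<comment> \<open>\<open>\<rho>\<close> does not charge the complement of \<open>Y\<close>, so the
    case of subsets of \<open>Y\<close> suffices.\<close>
  have ge: "emeasure \<rho> A \<le> (\<integral>\<^sup>+z. emeasure (P t z) A \<partial>\<rho>)" if t: "0 \<le> t" and A: "A \<in> sets borel" for t A
  proof -
    have "emeasure \<rho> A = emeasure \<rho> (A \<inter> Y)" using A by (simp add: \<rho>)
    also have "\<dots> \<le> (\<integral>\<^sup>+z. emeasure (P t z) (A \<inter> Y) \<partial>\<rho>)" using t A Y by (intro step) auto
    also have "\<dots> \<le> (\<integral>\<^sup>+z. emeasure (P t z) A \<partial>\<rho>)"
      using A t by (intro nn_integral_mono emeasure_mono) (auto simp: sets_P)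
    finally show ?thesis .
  qed
  have "(\<integral>\<^sup>+z. emeasure (P t z) A \<partial>\<rho>) = emeasure \<rho> A" if t: "0 \<le> t" and A [measurable]: "A \<in> sets borel" for t A
  proof -
    interpret \<rho>: finite_measure \<rho> by (rule \<rho>fin)
    have [measurable]: "(\<lambda>z. emeasure (P t z) A) \<in> borel_measurable borel" "(\<lambda>z. emeasure (P t z) (- A)) \<in> borel_measurable borel"
      using t A by (auto intro!: measurable_emeasure_kernel)
    have "(\<integral>\<^sup>+z. emeasure (P t z) A \<partial>\<rho>) + (\<integral>\<^sup>+z. emeasure (P t z) (- A) \<partial>\<rho>) =
        (\<integral>\<^sup>+z. emeasure (P t z) A + emeasure (P t z) (- A) \<partial>\<rho>)"
      by (rule nn_integral_add[symmetric]) auto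
    also have "\<dots> = (\<integral>\<^sup>+z. 1 \<partial>\<rho>)"
      using A t by (intro nn_integral_cong) (simp add: plus_emeasure sets_P emeasure_kernel_UNIV Compl_partition)
    also have "\<dots> = emeasure \<rho> A + emeasure \<rho> (- A)"
      using A by (simp add: plus_emeasure Compl_partition)
    finally have eq: "(\<integral>\<^sup>+z. emeasure (P t z) A \<partial>\<rho>) + (\<integral>\<^sup>+z. emeasure (P t z) (- A) \<partial>\<rho>) =
      emeasure \<rho> A + emeasure \<rho> (- A)" .
    \<comment> \<open>Lower bounds hold for \<open>A\<close> and for its complement while the totals
      agree, so neither can be strict.\<close>
    have le: "emeasure \<rho> (- A) \<le> (\<integral>\<^sup>+z. emeasure (P t z) (- A) \<partial>\<rho>)" using t A by (intro ge) auto
    have "(\<integral>\<^sup>+z. emeasure (P t z) A \<partial>\<rho>) + emeasure \<rho> (- A) \<le> emeasure \<rho> A + emeasure \<rho> (- A)"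
      unfolding eq[symmetric] using le by (intro add_left_mono)
    then have "(\<integral>\<^sup>+z. emeasure (P t z) A \<partial>\<rho>) \<le> emeasure \<rho> A"
      by (simp add: ennreal_add_left_cancel_le add.commute[of _ "emeasure \<rho> (- A)"])
    with ge[OF t A] show ?thesis by (intro antisym)
  qed
  then have "invariant_measure P \<rho>" using \<rho>fin by (simp add: invariant_measure_def)
  with \<rho> that show ?thesis by blast
qed

text \<open>The two parts are the positive parts of the difference in either order, living on
  \<open>Y\<close> and its complement. Both are nonzero because the total masses are equal: an
  excess on \<open>Y\<close> must be compensated off \<open>Y\<close>.\<close>

lemma distinct_invariant_probabilities_singular:
  assumes \<mu>: "invariant_probability P \<mu>" and \<nu>: "invariant_probability P \<nu>" and ne: "\<mu> \<noteq> \<nu>"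
  obtains \<mu>' \<nu>' Y where "invariant_measure P \<mu>'" "invariant_measure P \<nu>'" "Y \<in> sets borel"
    "emeasure \<mu>' (- Y) = 0" "emeasure \<nu>' Y = 0" "emeasure \<mu>' UNIV \<noteq> 0" "emeasure \<nu>' UNIV \<noteq> 0"
proof -
  have inv: "invariant_measure P \<mu>" "invariant_measure P \<nu>"
    using \<mu> \<nu> by (auto simp: invariant_measure_def invariant_probability_def prob_space.finite_measure)
  have s [simp]: "sets \<mu> = sets borel" "sets \<nu> = sets borel" using inv by (auto simp: invariant_measure_def)
  have sp [simp]: "space \<mu> = UNIV" "space \<nu> = UNIV" using s[THEN sets_eq_imp_space_eq] by auto
  interpret \<mu>: prob_space \<mu> using \<mu> by (simp add: invariant_probability_def)
  interpret \<nu>: prob_space \<nu> using \<nu> by (simp add: invariant_probability_def)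
  obtain Y where Y: "Y \<in> sets borel"
    "\<And>X. X \<in> sets borel \<Longrightarrow> X \<subseteq> Y \<Longrightarrow> emeasure \<nu> X \<le> emeasure \<mu> X"
    "\<And>X. X \<in> sets borel \<Longrightarrow> X \<inter> Y = {} \<Longrightarrow> emeasure \<mu> X \<le> emeasure \<nu> X"
    using finite_unsigned_Hahn_decomposition[of \<mu> \<nu>] \<mu>.finite_measure_axioms \<nu>.finite_measure_axioms by auto
  obtain \<mu>' where \<mu>': "invariant_measure P \<mu>'"
    "\<And>A. A \<in> sets borel \<Longrightarrow> emeasure \<mu>' A = emeasure \<mu> (A \<inter> Y) - emeasure \<nu> (A \<inter> Y)"
    using invariant_positive_part[OF inv Y] by blast
  have Y': "- Y \<in> sets borel" using Y(1) by auto
  obtain \<nu>' where \<nu>': "invariant_measure P \<nu>'"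
    "\<And>A. A \<in> sets borel \<Longrightarrow> emeasure \<nu>' A = emeasure \<nu> (A \<inter> - Y) - emeasure \<mu> (A \<inter> - Y)"
    by (rule invariant_positive_part[OF inv(2,1) Y'])
      (use Y in \<open>auto simp: disjoint_eq_subset_Compl\<close>)
  have tot: "\<mu>.prob Y + \<mu>.prob (- Y) = 1" "\<nu>.prob Y + \<nu>.prob (- Y) = 1"
    using Y(1) \<mu>.prob_compl[of Y] \<nu>.prob_compl[of Y] by (auto simp: Compl_eq_Diff_UNIV)
  \<comment> \<open>On \<open>Y\<close> one measure dominates on every subset, so equal mass of
    \<open>Y\<close> would force equality on every subset; likewise on the complement.\<close>
  have "\<mu>.prob Y \<noteq> \<nu>.prob Y"
  proof
    assume eqY: "\<mu>.prob Y = \<nu>.prob Y"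
    with tot have eqN: "\<mu>.prob (- Y) = \<nu>.prob (- Y)" by simp
    have "\<mu> = \<nu>"
    proof (rule measure_eqI)
      fix A assume "A \<in> sets \<mu>"
      then have A: "A \<in> sets borel" by simp
      have le: "\<nu>.prob X \<le> \<mu>.prob X" if "X \<in> sets borel" "X \<subseteq> Y" for X
        using Y(2)[OF that] by (simp add: \<mu>.emeasure_eq_measure \<nu>.emeasure_eq_measure)
      have ge: "\<mu>.prob X \<le> \<nu>.prob X" if "X \<in> sets borel" "X \<subseteq> - Y" for X
        using Y(3)[of X] that by (auto simp: \<mu>.emeasure_eq_measure \<nu>.emeasure_eq_measure)
      have split: "measure m S = measure m (S \<inter> A) + measure m (S - A)" if "S \<in> sets borel" "m = \<mu> \<or> m = \<nu>" for m S
        using that A \<mu>.finite_measure_Union[of "S \<inter> A" "S - A"] \<nu>.finite_measure_Union[of "S \<inter> A" "S - A"]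
        by (auto simp: Int_Diff_Un Int_Diff_disjoint)
      have 1: "\<mu>.prob (Y \<inter> A) = \<nu>.prob (Y \<inter> A)"
        using split[OF Y(1), of \<mu>] split[OF Y(1), of \<nu>] le[of "Y \<inter> A"] le[of "Y - A"] eqY A Y(1) by auto
      have 2: "\<mu>.prob (- Y \<inter> A) = \<nu>.prob (- Y \<inter> A)"
        using split[OF Y', of \<mu>] split[OF Y', of \<nu>] ge[of "- Y \<inter> A"] ge[of "- Y - A"] eqN A Y' by auto
      have "measure m A = measure m (Y \<inter> A) + measure m (- Y \<inter> A)" if "m = \<mu> \<or> m = \<nu>" for m
      proof -
        have "A = (Y \<inter> A) \<union> (- Y \<inter> A)" by auto
        then show ?thesis
          using that A Y(1) Y' \<mu>.finite_measure_Union[of "Y \<inter> A" "- Y \<inter> A"] \<nu>.finite_measure_Union[of "Y \<inter> A" "- Y \<inter> A"]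
          by auto
      qed
      then show "emeasure \<mu> A = emeasure \<nu> A"
        using 1 2 by (simp add: \<mu>.emeasure_eq_measure \<nu>.emeasure_eq_measure)
    qed simp
    with ne show False by simp
  qed
  moreover have "\<nu>.prob Y \<le> \<mu>.prob Y" "\<mu>.prob (- Y) \<le> \<nu>.prob (- Y)"
    using Y(2)[of Y] Y(3)[of "- Y"] Y(1) by (auto simp: \<mu>.emeasure_eq_measure \<nu>.emeasure_eq_measure)
  ultimately have "\<nu>.prob Y < \<mu>.prob Y" "\<mu>.prob (- Y) < \<nu>.prob (- Y)" using tot by linarith+
  then have "emeasure \<mu>' UNIV \<noteq> 0" "emeasure \<nu>' UNIV \<noteq> 0"
    using \<mu>'(2)[of UNIV] \<nu>'(2)[of UNIV]
    by (auto simp: \<mu>.emeasure_eq_measure \<nu>.emeasure_eq_measure ennreal_minus)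
  moreover have "emeasure \<mu>' (- Y) = 0" "emeasure \<nu>' Y = 0"
    using \<mu>'(2)[OF Y'] \<nu>'(2)[OF Y(1)] by auto
  ultimately show ?thesis using that \<mu>'(1) \<nu>'(1) Y(1) by blast
qed

end

section \<open>Supports of invariant measures\<close>

definition measure_support :: "'a::metric_space measure \<Rightarrow> 'a set" where
  "measure_support \<mu> = {z. \<forall>\<epsilon>>0. emeasure \<mu> (ball z \<epsilon>) \<noteq> 0}"

lemma closed_measure_support:
  assumes s: "sets \<mu> = sets borel"
  shows "closed (measure_support \<mu>)"
proof -
  have "open (- measure_support \<mu>)"
    unfolding open_contains_ball
  proof
    fix z assume "z \<in> - measure_support \<mu>"
    then obtain \<epsilon> where \<epsilon>: "0 < \<epsilon>" "emeasure \<mu> (ball z \<epsilon>) = 0" by (auto simp: measure_support_def)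
    have "ball z (\<epsilon> / 2) \<subseteq> - measure_support \<mu>"
    proof
      fix y assume y: "y \<in> ball z (\<epsilon> / 2)"
      have "ball y (\<epsilon> / 2) \<subseteq> ball z \<epsilon>"
      proof
        fix x assume "x \<in> ball y (\<epsilon> / 2)"
        then show "x \<in> ball z \<epsilon>" using y dist_triangle[of z x y] by simp
      qed
      then have "emeasure \<mu> (ball y (\<epsilon> / 2)) \<le> emeasure \<mu> (ball z \<epsilon>)" using s by (intro emeasure_mono) auto
      then have "emeasure \<mu> (ball y (\<epsilon> / 2)) = 0" using \<epsilon> by simp
      then show "y \<in> - measure_support \<mu>" using \<epsilon> by (auto simp: measure_support_def intro!: exI[of _ "\<epsilon> / 2"])
    qed
    then show "\<exists>e>0. ball z e \<subseteq> - measure_support \<mu>" using \<epsilon>(1) by (intro exI[of _ "\<epsilon> / 2"]) auto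
  qed
  then show ?thesis by (simp add: closed_def)
qed

text \<open>The complement is covered by null balls; second countability (Lindelof) leaves countably
  many of them.\<close>

lemma emeasure_Compl_support:
  fixes \<mu> :: "'a::{metric_space, second_countable_topology} measure"
  assumes s: "sets \<mu> = sets borel"
  shows "emeasure \<mu> (- measure_support \<mu>) = 0"
proof -
  define \<F> where "\<F> = {ball z \<epsilon> | z \<epsilon>. 0 < \<epsilon> \<and> emeasure \<mu> (ball z \<epsilon>) = 0}"
  obtain \<F>' where \<F>': "\<F>' \<subseteq> \<F>" "countable \<F>'" "\<Union>\<F>' = \<Union>\<F>"
    using Lindelof[of \<F>] by (auto simp: \<F>_def)
  have "(\<Union>B\<in>\<F>'. B) \<in> null_sets \<mu>"
  proof (rule null_sets_UN'[OF \<F>'(2)])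
    fix B assume "B \<in> \<F>'"
    then obtain z \<epsilon> where "B = ball z \<epsilon>" "emeasure \<mu> (ball z \<epsilon>) = 0" using \<F>'(1) by (auto simp: \<F>_def)
    then show "B \<in> null_sets \<mu>" using s by (simp add: null_sets_def)
  qed
  then have n: "\<Union>\<F> \<in> null_sets \<mu>" using \<F>'(3) by simp
  have "- measure_support \<mu> \<subseteq> \<Union>\<F>"
    by (auto simp: measure_support_def \<F>_def) (metis centre_in_ball)
  then have "emeasure \<mu> (- measure_support \<mu>) \<le> emeasure \<mu> (\<Union>\<F>)" using n by (intro emeasure_mono) auto
  then show ?thesis using n by (simp add: null_sets_def)
qed

context feller_kernels begin

text \<open>The starting points from which the open complement is charged form an open set. If it
  contained a point of the support, \<open>\<mu>\<close> would charge it, and by invariance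
  \<open>\<mu>\<close> would charge the complement of its own support.\<close>

lemma kernel_stays_in_support:
  assumes \<mu>: "invariant_measure P \<mu>" and t: "0 \<le> t" and z: "z \<in> measure_support \<mu>"
  shows "emeasure (P t z) (- measure_support \<mu>) = 0"
proof (rule ccontr)
  assume ne: "emeasure (P t z) (- measure_support \<mu>) \<noteq> 0"
  have s [simp, measurable_cong]: "sets \<mu> = sets borel" using \<mu> by (auto simp: invariant_measure_def)
  let ?U = "- measure_support \<mu>"
  have U: "open ?U" using closed_measure_support[OF s] by (simp add: open_Compl)
  have [measurable]: "(\<lambda>z. emeasure (P t z) ?U) \<in> borel_measurable borel"
    using t U by (intro measurable_emeasure_kernel) auto
  obtain \<epsilon> where \<epsilon>: "0 < \<epsilon>" "ball z \<epsilon> \<subseteq> {z. 0 < emeasure (P t z) ?U}"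
    using open_emeasure_greater[OF t U, of 0] ne unfolding open_contains_ball by (auto simp: zero_less_iff_neq_zero)
  have "(\<integral>\<^sup>+z. emeasure (P t z) ?U \<partial>\<mu>) = 0"
    using \<mu> t U emeasure_Compl_support[OF s] by (simp add: invariant_measure_def)
  then have "AE z in \<mu>. emeasure (P t z) ?U = 0" by (subst (asm) nn_integral_0_iff_AE) auto
  then have "AE z' in \<mu>. z' \<notin> ball z \<epsilon>" by eventually_elim (use \<epsilon>(2) in force)
  then have "emeasure \<mu> (ball z \<epsilon>) = 0" by (subst (asm) AE_iff_null_sets[symmetric]) (auto simp: null_sets_def)
  with z \<epsilon>(1) show False by (auto simp: measure_support_def)
qed

end

section \<open>The asymptotic strong Feller property\<close>

lemma totally_separating_le_1:
  assumes "totally_separating_system d" shows "d m x y \<le> 1"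
proof (cases "x = y")
  case True
  then show ?thesis using assms by (simp add: totally_separating_system_def pseudo_metric_def)
next
  case False
  then show ?thesis
    using assms incseq_le[of "\<lambda>m. d m x y" 1 m] by (simp add: totally_separating_system_def)
qed

text \<open>A Dini argument: the open sets \<open>U m\<close> cover the compact product, finitely
  many suffice, and monotonicity in \<open>m\<close> lets a single index replace them.\<close>

lemma totally_separating_eventually_large:
  fixes K1 K2 :: "'a::metric_space set"
  assumes d: "totally_separating_system d" and K: "compact K1" "compact K2" "K1 \<inter> K2 = {}" and \<eta>: "0 < \<eta>"
  shows "eventually (\<lambda>m. \<forall>x\<in>K1. \<forall>y\<in>K2. 1 - \<eta> < d m x y) sequentially"
proof -
  define U where "U m = {p. 1 - \<eta> < d m (fst p) (snd p)}" for m
  have U: "open (U m)" for m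
    unfolding U_def using d
    by (intro open_Collect_less continuous_intros) (simp add: totally_separating_system_def case_prod_beta')
  have "K1 \<times> K2 \<subseteq> (\<Union>m. U m)"
  proof (clarify)
    fix x y assume "x \<in> K1" "y \<in> K2"
    then have "x \<noteq> y" using K(3) by auto
    then have "(\<lambda>m. d m x y) \<longlonglongrightarrow> 1" using d by (simp add: totally_separating_system_def)
    then have "eventually (\<lambda>m. 1 - \<eta> < d m x y) sequentially" by (rule order_tendstoD) (use \<eta> in simp)
    then show "(x, y) \<in> (\<Union>m. U m)" by (auto simp: U_def eventually_sequentially)
  qed
  then obtain S where S: "finite S" "K1 \<times> K2 \<subseteq> (\<Union>m\<in>S. U m)"
    using compactE_image[OF compact_Times[OF K(1,2)], of UNIV U] U by auto
  obtain N where N: "\<And>m. m \<in> S \<Longrightarrow> m \<le> N" using S(1) finite_nat_set_iff_bounded_le by auto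
  have "1 - \<eta> < d n x y" if "N \<le> n" "x \<in> K1" "y \<in> K2" for n x y
  proof -
    have "(x, y) \<in> (\<Union>m\<in>S. U m)" using S(2) that(2,3) by (intro subsetD[OF S(2)]) simp
    then obtain m where m: "m \<in> S" "1 - \<eta> < d m x y" by (auto simp: U_def)
    have "incseq (\<lambda>m. d m x y)" using d by (simp add: totally_separating_system_def)
    then have "d m x y \<le> d n x y" using N[OF m(1)] that(1) by (auto simp: incseq_def)
    with m show ?thesis by simp
  qed
  then show ?thesis unfolding eventually_sequentially by blast
qed

text \<open>The easy half of Kantorovich duality: integrate \<open>le\<close> against a nearly
  optimal coupling.\<close>

lemma coupling_dist_bound:
  fixes \<mu> \<nu> :: "'a::{metric_space, second_countable_topology} measure"
  assumes f: "f \<in> borel_measurable borel" and d: "continuous_on UNIV (\<lambda>(x, y). d x y)"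
    and le: "\<And>x y. f x \<le> f y + ennreal (d x y)" and lt: "coupling_dist d \<mu> \<nu> < b"
  shows "(\<integral>\<^sup>+x. f x \<partial>\<mu>) \<le> (\<integral>\<^sup>+x. f x \<partial>\<nu>) + b"
proof -
  obtain \<Gamma> where \<Gamma>: "\<Gamma> \<in> couplings \<mu> \<nu>" "(\<integral>\<^sup>+(x, y). ennreal (d x y) \<partial>\<Gamma>) < b"
    using lt by (auto simp: coupling_dist_def INF_less_iff)
  have marg: "distr \<Gamma> borel fst = \<mu>" "distr \<Gamma> borel snd = \<nu>" using \<Gamma>(1) by (auto simp: couplings_def)
  have [measurable_cong]: "sets \<mu> = sets borel" "sets \<nu> = sets borel" by (simp_all flip: marg)
  have s [measurable_cong]: "sets \<Gamma> = sets (borel \<Otimes>\<^sub>M borel)" using \<Gamma>(1) by (simp add: couplings_def)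
  have [measurable]: "(\<lambda>p. d (fst p) (snd p)) \<in> borel_measurable (borel \<Otimes>\<^sub>M borel)"
    unfolding borel_prod using d by (intro borel_measurable_continuous_onI) (simp add: case_prod_beta')
  note f[measurable]
  have "(\<integral>\<^sup>+x. f x \<partial>\<mu>) = (\<integral>\<^sup>+p. f (fst p) \<partial>\<Gamma>)"
    using nn_integral_distr[of fst \<Gamma> borel f] by (simp add: marg cong: measurable_cong_sets)
  also have "\<dots> \<le> (\<integral>\<^sup>+p. f (snd p) + ennreal (d (fst p) (snd p)) \<partial>\<Gamma>)"
    using le by (intro nn_integral_mono) simp
  also have "\<dots> = (\<integral>\<^sup>+p. f (snd p) \<partial>\<Gamma>) + (\<integral>\<^sup>+p. ennreal (d (fst p) (snd p)) \<partial>\<Gamma>)"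
    by (intro nn_integral_add) measurable
  also have "(\<integral>\<^sup>+p. f (snd p) \<partial>\<Gamma>) = (\<integral>\<^sup>+x. f x \<partial>\<nu>)"
    using nn_integral_distr[of snd \<Gamma> borel f] by (simp add: marg cong: measurable_cong_sets)
  finally show ?thesis using \<Gamma>(2) by (auto simp: case_prod_beta' intro: order_trans add_left_mono less_imp_le)
qed

text \<open>The radius is fixed first, and closeness then holds for all large \<open>m\<close>. This
  leaves room to choose \<open>m\<close> after compact sets that depend on the mass of the
  ball.\<close>

lemma asymptotically_strong_FellerE:
  assumes "asymptotically_strong_Feller_at P c" and \<epsilon>: "0 < \<epsilon>"
  obtains d t \<gamma> where "totally_separating_system d" "\<And>m::nat. 0 < t m" "0 < \<gamma>"
    "eventually (\<lambda>m. \<forall>y\<in>ball c \<gamma>. coupling_dist (d m) (P (t m) c) (P (t m) y) < ennreal \<epsilon>) sequentially"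
proof -
  obtain d t where dt: "totally_separating_system d" "\<And>m::nat. 0 < t m"
    "((\<lambda>\<gamma>. limsup (\<lambda>m. SUP y\<in>ball c \<gamma>. coupling_dist (d m) (P (t m) c) (P (t m) y))) \<longlongrightarrow> 0) (at_right 0)"
    using assms(1) unfolding asymptotically_strong_Feller_at_def by blast
  have "eventually (\<lambda>\<gamma>. limsup (\<lambda>m. SUP y\<in>ball c \<gamma>. coupling_dist (d m) (P (t m) c) (P (t m) y)) < ennreal \<epsilon>) (at_right 0)"
    using dt(3) by (rule order_tendstoD) (use \<epsilon> in simp)
  moreover have "eventually (\<lambda>\<gamma>::real. 0 < \<gamma>) (at_right 0)" by (simp add: eventually_at_right_less)
  ultimately have "eventually (\<lambda>\<gamma>. 0 < \<gamma> \<and> limsup (\<lambda>m. SUP y\<in>ball c \<gamma>. coupling_dist (d m) (P (t m) c) (P (t m) y)) < ennreal \<epsilon>) (at_right 0)"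
    by (auto intro: eventually_conj)
  then obtain \<gamma> where \<gamma>: "0 < \<gamma>"
    "limsup (\<lambda>m. SUP y\<in>ball c \<gamma>. coupling_dist (d m) (P (t m) c) (P (t m) y)) < ennreal \<epsilon>"
    using eventually_happens'[OF trivial_limit_at_right_real] by blast
  from Limsup_lessD[OF this(2)]
  have "eventually (\<lambda>m. \<forall>y\<in>ball c \<gamma>. coupling_dist (d m) (P (t m) c) (P (t m) y) < ennreal \<epsilon>) sequentially"
    by eventually_elim (auto dest: SUP_lessD)
  with that dt(1,2) \<gamma>(1) show ?thesis by blast
qed

text \<open>A coupling of the two transition kernels changes the integral of a \<open>d m\<close>-Lipschitz function by
  at most its \<open>d m\<close>-cost, so the distance to a compact set carrying most of \<open>\<nu>\<close>, which
  almost separates \<open>\<mu>\<close> from \<open>\<nu>\<close>, is sent by the semigroup to a function that is nearly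
  constant on a ball charged by both measures. Testing against functions avoids choosing the couplings
  measurably.\<close>

lemma asymptotically_strong_Feller_not_singular:
  fixes P :: "real \<Rightarrow> 'a::{complete_space, second_countable_topology} \<Rightarrow> 'a measure"
  assumes "feller_kernels P"
    and asf: "asymptotically_strong_Feller_at P c"
    and \<mu>: "invariant_measure P \<mu>" and \<nu>: "invariant_measure P \<nu>" and Y [measurable]: "Y \<in> sets borel"
    and sing: "emeasure \<mu> (- Y) = 0" "emeasure \<nu> Y = 0"
    and c: "c \<in> measure_support \<mu>" "c \<in> measure_support \<nu>"
  shows False
proof -
  interpret feller_kernels P by fact
  obtain d t \<gamma> where d: "totally_separating_system d" and t: "\<And>m::nat. 0 < t m" and \<gamma>: "0 < \<gamma>"
    and ev: "eventually (\<lambda>m. \<forall>y\<in>ball c \<gamma>. coupling_dist (d m) (P (t m) c) (P (t m) y) < ennreal (1 / 4)) sequentially"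
    using asymptotically_strong_FellerE[OF asf, of "1 / 4"] by auto
  let ?B = "ball c \<gamma>"
  have s [simp, measurable_cong]: "sets \<mu> = sets borel" "sets \<nu> = sets borel"
    using \<mu> \<nu> by (auto simp: invariant_measure_def)
  have sp [simp]: "space \<mu> = UNIV" "space \<nu> = UNIV" using s[THEN sets_eq_imp_space_eq] by auto
  interpret \<mu>: finite_measure \<mu> using \<mu> by (simp add: invariant_measure_def)
  interpret \<nu>: finite_measure \<nu> using \<nu> by (simp add: invariant_measure_def)
  define \<alpha> where "\<alpha> = min (measure \<mu> ?B) (measure \<nu> ?B)"
  have \<alpha>: "0 < \<alpha>" using c \<gamma>
    by (auto simp: \<alpha>_def measure_support_def \<mu>.emeasure_eq_measure \<nu>.emeasure_eq_measure zero_less_measure_iff)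
  \<comment> \<open>Each measure gives the ball at least \<open>\<alpha>\<close>, so a function that
    is at least 1/4 there has integral at least \<open>\<alpha> / 4\<close>. The factor 8 puts both
    competing upper bounds, \<open>\<eta>\<close> and
    \<open>\<eta> * (1 + measure \<mu> UNIV)\<close>, below this.\<close>
  define \<eta> where "\<eta> = \<alpha> / (8 * (1 + measure \<mu> UNIV))"
  have \<eta>: "0 < \<eta>" "\<eta> * (1 + measure \<mu> UNIV) < \<alpha> / 4" "\<eta> < \<alpha> / 4"
  proof -
    have m: "0 < 1 + measure \<mu> UNIV" by (simp add: add_pos_nonneg)
    show \<eta>0: "0 < \<eta>" using \<alpha> m by (simp add: \<eta>_def)
    have eq: "\<eta> * (1 + measure \<mu> UNIV) = \<alpha> / 8" 
    proof -
      have "a / (8 * b) * b = a / 8" if "0 < b" for a b :: real using that by simp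
      from this[OF m] show ?thesis by (simp only: \<eta>_def)
    qed
    then show "\<eta> * (1 + measure \<mu> UNIV) < \<alpha> / 4" using \<alpha> by simp
    have "\<eta> * 1 \<le> \<eta> * (1 + measure \<mu> UNIV)" using \<eta>0 by (intro mult_left_mono) auto
    then show "\<eta> < \<alpha> / 4" using eq \<alpha> by simp
  qed
  \<comment> \<open>Inner regularity of finite Borel measures on a complete separable space.\<close>
  have approx: "\<exists>K. compact K \<and> K \<subseteq> X \<and> emeasure m (- K) \<le> ennreal \<eta>"
    if m: "finite_measure m" "sets m = sets borel" and X: "X \<in> sets borel" "emeasure m (- X) = 0" for m :: "'a measure" and X
  proof -
    interpret m: finite_measure m by fact
    have spm: "space m = UNIV" using sets_eq_imp_space_eq[OF m(2)] by simp
    have tot: "measure m X = measure m UNIV"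
    proof -
      have "measure m (- X) = 0" using X(2) by (simp add: measure_def)
      then show ?thesis using X(1) m.finite_measure_compl[of X] by (simp add: m(2) spm Compl_eq_Diff_UNIV)
    qed
    show ?thesis
    proof (cases "measure m UNIV \<le> \<eta>")
      case True
      then show ?thesis by (intro exI[of _ "{}"]) (auto simp: m.emeasure_eq_measure intro!: ennreal_leI)
    next
      case False
      have "ennreal (measure m UNIV - \<eta>) < emeasure m X"
        using False \<eta>(1) by (simp add: m.emeasure_eq_measure tot ennreal_less_iff)
      then obtain K where K: "K \<subseteq> X" "compact K" "ennreal (measure m UNIV - \<eta>) < emeasure m K"
        using inner_regular[OF m(2) _ X(1)] by (auto simp: less_SUP_iff)
      have "measure m (- K) = measure m UNIV - measure m K"
        using m.finite_measure_compl[of K] compact_imp_closed[OF K(2)] by (simp add: m(2) spm Compl_eq_Diff_UNIV)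
      also have "\<dots> \<le> \<eta>" using K(3) False by (simp add: m.emeasure_eq_measure ennreal_less_iff)
      finally show ?thesis using K by (auto simp: m.emeasure_eq_measure intro!: ennreal_leI)
    qed
  qed
  obtain K1 where K1: "compact K1" "K1 \<subseteq> Y" "emeasure \<mu> (- K1) \<le> ennreal \<eta>"
    using approx[OF \<mu>.finite_measure_axioms _ Y sing(1)] by auto
  obtain K2 where K2: "compact K2" "K2 \<subseteq> - Y" "emeasure \<nu> (- K2) \<le> ennreal \<eta>"
    using approx[OF \<nu>.finite_measure_axioms, of "- Y"] sing(2) Y by auto
  have [measurable]: "K1 \<in> sets borel" "K2 \<in> sets borel"
    using K1(1) K2(1) by (auto intro: borel_closed compact_imp_closed)
  \<comment> \<open>The infimum defining \<open>f\<close> is taken in the reals and needs a nonempty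
    index set.\<close>
  have K2ne: "K2 \<noteq> {}"
  proof
    assume "K2 = {}"
    then have "measure \<nu> UNIV \<le> \<eta>" using K2(3) \<eta>(1) by (simp add: \<nu>.emeasure_eq_measure)
    moreover have "measure \<nu> ?B \<le> measure \<nu> UNIV" by (intro \<nu>.finite_measure_mono) auto
    ultimately show False using \<eta>(3) \<alpha> by (auto simp: \<alpha>_def)
  qed
  have "K1 \<inter> K2 = {}" using K1(2) K2(2) by auto
  from eventually_conj[OF ev totally_separating_eventually_large[OF d K1(1) K2(1) this \<eta>(1)]]
  obtain m where m: "\<And>y. y \<in> ?B \<Longrightarrow> coupling_dist (d m) (P (t m) c) (P (t m) y) < ennreal (1 / 4)"
    and large: "\<And>x y. x \<in> K1 \<Longrightarrow> y \<in> K2 \<Longrightarrow> 1 - \<eta> < d m x y"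
    using eventually_happens'[OF sequentially_bot] by blast
  have pm: "0 \<le> d m x y" "d m x x = 0" "d m x y = d m y x" "d m x z \<le> d m x y + d m y z" for x y z
    using d by (auto simp: totally_separating_system_def pseudo_metric_def)
  have dc: "continuous_on UNIV (\<lambda>(x, y). d m x y)" using d by (simp add: totally_separating_system_def)
  \<comment> \<open>The \<open>d m\<close>-distance to \<open>K2\<close>: zero on \<open>K2\<close>,
    at least \<open>1 - \<eta>\<close> on \<open>K1\<close>, and 1-Lipschitz for
    \<open>d m\<close>.\<close>
  define f where "f x = (INF k\<in>K2. d m x k)" for x
  have bdd: "bdd_below (d m x ` K2)" for x using pm(1) by (intro bdd_belowI[of _ 0]) auto
  have f0: "0 \<le> f x" for x unfolding f_def using K2ne pm(1) by (intro cINF_greatest) auto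
  have f1: "f x \<le> 1" for x
  proof -
    obtain k where "k \<in> K2" using K2ne by blast
    then have "f x \<le> d m x k" unfolding f_def using bdd by (intro cINF_lower)
    then show ?thesis using totally_separating_le_1[OF d, of m x k] by simp
  qed
  have f_lip: "f x \<le> f y + d m x y" for x y
  proof -
    have "f x - d m x y \<le> f y"
      unfolding f_def[of y]
    proof (rule cINF_greatest[OF K2ne])
      fix k assume "k \<in> K2"
      then have "f x \<le> d m x k" unfolding f_def using bdd by (intro cINF_lower)
      then show "f x - d m x y \<le> d m y k" using pm(4)[of x k y] by simp
    qed
    then show ?thesis by simp
  qed
  have fK2: "f x = 0" if "x \<in> K2" for x
    using cINF_lower[OF bdd that, of x] pm(2)[of x] f0[of x] by (simp add: f_def)
  have fK1: "1 - \<eta> \<le> f x" if "x \<in> K1" for x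
    unfolding f_def using K2ne large[OF that] by (intro cINF_greatest) (auto intro: less_imp_le)
  have "continuous_on UNIV f"
    unfolding continuous_on_eq_continuous_at[OF open_UNIV] isCont_def
  proof
    fix x
    have "continuous_on UNIV (\<lambda>y. d m y x)"
      using continuous_on_compose2[OF dc, of UNIV "\<lambda>y. (y, x)"]
      by (simp add: continuous_on_Pair continuous_on_id continuous_on_const)
    then have lim: "((\<lambda>y. d m y x) \<longlongrightarrow> 0) (at x)"
      unfolding continuous_on_eq_continuous_at[OF open_UNIV] isCont_def using pm(2)[of x] by (metis UNIV_I)
    show "(f \<longlongrightarrow> f x) (at x)"
    proof (rule Lim_null_comparison[OF _ lim, THEN LIM_zero_cancel], intro always_eventually allI)
      fix y show "norm (f y - f x) \<le> d m y x"
        using f_lip[of x y] f_lip[of y x] pm(3)[of x y] by (simp add: abs_le_iff)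
    qed
  qed
  then have f_m [measurable]: "f \<in> borel_measurable borel" by (rule borel_measurable_continuous_onI)
  \<comment> \<open>Both \<open>f\<close> and its complement to 1 are needed: their averages under
    the kernel at \<open>c\<close> sum to 1, so one of them is at least 1/2, but it is not known
    which.\<close>
  define g where "g x = ennreal (f x)" for x
  define h where "h x = ennreal (1 - f x)" for x
  have [measurable]: "g \<in> borel_measurable borel" "h \<in> borel_measurable borel"
    by (auto simp: g_def[abs_def] h_def[abs_def])
  have lip: "g x \<le> g y + ennreal (d m x y)" "h x \<le> h y + ennreal (d m x y)" for x y
    using f_lip[of x y] f_lip[of y x] pm(1)[of x y] pm(3)[of x y] f0 f1
    by (auto simp: g_def h_def simp flip: ennreal_plus intro!: ennreal_leI)
  have t0: "0 \<le> t m" using t[of m] by simp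
  have Ps [measurable_cong]: "sets (P (t m) z) = sets borel" for z using sets_P[OF t0] .
  define G where "G z = (\<integral>\<^sup>+x. g x \<partial>P (t m) z)" for z
  define I where "I z = (\<integral>\<^sup>+x. h x \<partial>P (t m) z)" for z
  have "G c + I c = (\<integral>\<^sup>+x. g x + h x \<partial>P (t m) c)"
    unfolding G_def I_def by (intro nn_integral_add[symmetric]) measurable
  also have "\<dots> = (\<integral>\<^sup>+x. 1 \<partial>P (t m) c)"
    using f0 f1 by (intro nn_integral_cong) (simp add: g_def h_def flip: ennreal_plus)
  also have "\<dots> = 1" using emeasure_kernel_UNIV[OF t0] sets_eq_imp_space_eq[OF Ps] by simp
  finally have sum1: "G c + I c = 1" .
  have near: "G c \<le> G y + ennreal (1 / 4)" "I c \<le> I y + ennreal (1 / 4)" if "y \<in> ?B" for y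
    unfolding G_def I_def using m[OF that] dc lip
    by (auto intro!: coupling_dist_bound)
  have quarter: "ennreal (1 / 4) \<le> F y"
    if "ennreal (1 / 2) \<le> F c" "F c \<le> F y + ennreal (1 / 4)" for F :: "'a \<Rightarrow> ennreal" and y
  proof -
    have "ennreal (1 / 4) + ennreal (1 / 4) = ennreal (1 / 2)" by (subst ennreal_plus[symmetric]) auto
    also have "\<dots> \<le> F y + ennreal (1 / 4)" by (rule order_trans[OF that])
    also have "\<dots> = ennreal (1 / 4) + F y" by (rule add.commute)
    finally show ?thesis by (subst (asm) ennreal_add_left_cancel_le) auto
  qed
  have lower: "ennreal (1 / 4 * measure \<rho> ?B) \<le> (\<integral>\<^sup>+z. F z \<partial>\<rho>)"
    if "finite_measure \<rho>" "sets \<rho> = sets borel" and F: "\<And>y. y \<in> ?B \<Longrightarrow> ennreal (1 / 4) \<le> F y"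
    for \<rho> :: "'a measure" and F
  proof -
    interpret \<rho>: finite_measure \<rho> by fact
    have "ennreal (1 / 4 * measure \<rho> ?B) = (\<integral>\<^sup>+z. ennreal (1 / 4) * indicator ?B z \<partial>\<rho>)"
      using that(2) by (subst nn_integral_cmult_indicator) (auto simp: \<rho>.emeasure_eq_measure simp flip: ennreal_mult)
    also have "\<dots> \<le> (\<integral>\<^sup>+z. F z \<partial>\<rho>)"
      using F by (intro nn_integral_mono) (auto simp: indicator_def)
    finally show ?thesis .
  qed
  have "ennreal (1 / 2) \<le> G c \<or> ennreal (1 / 2) \<le> I c"
  proof (rule ccontr)
    assume "\<not> ?thesis"
    then have lt: "G c < ennreal (1 / 2)" "I c < ennreal (1 / 2)" by auto
    obtain a b where ab: "G c = ennreal a" "0 \<le> a" "I c = ennreal b" "0 \<le> b"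
      using lt by (cases "G c"; cases "I c") auto
    then have "ennreal (a + b) = 1" using sum1 by simp
    then have "a + b = 1" by (simp del: ennreal_plus)
    moreover have "a < 1 / 2" "b < 1 / 2" using lt ab(2,4) unfolding ab(1,3) by (simp_all only: ennreal_less_iff)
    ultimately show False by simp
  qed
  then show False
  proof
    \<comment> \<open>\<open>\<nu>\<close> is tested: invariance replaces \<open>G\<close> by
      \<open>g\<close>, which vanishes on \<open>K2\<close>, so its integral is at most
      \<open>\<eta>\<close>.\<close>
    assume "ennreal (1 / 2) \<le> G c"
    then have "ennreal (1 / 4 * measure \<nu> ?B) \<le> (\<integral>\<^sup>+z. G z \<partial>\<nu>)"
      using near quarter[of G] by (intro lower \<nu>.finite_measure_axioms) auto
    also have "\<dots> = (\<integral>\<^sup>+z. g z \<partial>\<nu>)"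
      unfolding G_def by (rule nn_integral_invariant_measure[OF \<nu> t0]) simp
    also have "\<dots> \<le> (\<integral>\<^sup>+z. indicator (- K2) z \<partial>\<nu>)"
      using fK2 f1 by (intro nn_integral_mono) (auto simp: indicator_def g_def)
    also have "\<dots> \<le> ennreal \<eta>" using K2(3) by (subst nn_integral_indicator) auto
    finally have "1 / 4 * measure \<nu> ?B \<le> \<eta>" using \<eta>(1) by (simp add: ennreal_le_iff)
    then show False using \<eta>(3) by (simp add: \<alpha>_def min_def split: if_splits)
  next
    \<comment> \<open>\<open>\<mu>\<close> is tested: \<open>h\<close> is at most
      \<open>\<eta>\<close> on \<open>K1\<close> and at most 1 elsewhere.\<close>
    assume "ennreal (1 / 2) \<le> I c"
    then have "ennreal (1 / 4 * measure \<mu> ?B) \<le> (\<integral>\<^sup>+z. I z \<partial>\<mu>)"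
      using near quarter[of I] by (intro lower \<mu>.finite_measure_axioms) auto
    also have "\<dots> = (\<integral>\<^sup>+z. h z \<partial>\<mu>)"
      unfolding I_def by (rule nn_integral_invariant_measure[OF \<mu> t0]) simp
    also have "\<dots> \<le> (\<integral>\<^sup>+z. indicator (- K1) z + ennreal \<eta> \<partial>\<mu>)"
    proof (intro nn_integral_mono)
      fix x show "h x \<le> indicator (- K1) x + ennreal \<eta>"
        using fK1[of x] f0[of x] by (cases "x \<in> K1") (auto simp: h_def intro!: ennreal_leI add_increasing2)
    qed
    also have "\<dots> = emeasure \<mu> (- K1) + ennreal \<eta> * emeasure \<mu> UNIV"
      by (subst nn_integral_add) auto
    also have "\<dots> \<le> ennreal \<eta> + ennreal \<eta> * ennreal (measure \<mu> UNIV)"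
      using K1(3) by (intro add_mono) (auto simp: \<mu>.emeasure_eq_measure)
    also have "\<dots> = ennreal (\<eta> * (1 + measure \<mu> UNIV))"
      using \<eta>(1) by (simp add: distrib_left flip: ennreal_mult ennreal_plus)
    finally have "1 / 4 * measure \<mu> ?B \<le> \<eta> * (1 + measure \<mu> UNIV)"
      using \<eta>(1) by (subst (asm) ennreal_le_iff) auto
    then show False using \<eta>(2) by (simp add: \<alpha>_def min_def split: if_splits)
  qed
qed

section \<open>The heat conduction network\<close>

text \<open>Dyadic times are dense in the interval. This turns almost sure statements at countably
  many times into statements about the entire path.\<close>

lemma closed_path_dyadic:
  fixes x :: "real \<Rightarrow> 'a::topological_space"
  assumes x: "continuous_on {0..T} x" and C: "closed C" and T: "0 < T"
    and dy: "\<And>n j. j \<le> 2 ^ n \<Longrightarrow> x (T * real j / 2 ^ n) \<in> C" and t: "t \<in> {0..T}"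
  shows "x t \<in> C"
proof -
  define s where "s n = T * real (nat \<lfloor>t / T * 2 ^ n\<rfloor>) / 2 ^ n" for n :: nat
  have nn: "0 \<le> t / T * 2 ^ n" for n using t T by auto
  have le: "nat \<lfloor>t / T * 2 ^ n\<rfloor> \<le> 2 ^ n" for n
  proof -
    have "t / T * 2 ^ n \<le> 1 * 2 ^ n" using t T by (intro mult_right_mono) auto
    then show ?thesis by (simp add: nat_le_iff floor_le_iff)
  qed
  have close: "\<bar>s n - t\<bar> \<le> T * (1 / 2) ^ n" for n
  proof -
    have "\<bar>real (nat \<lfloor>t / T * 2 ^ n\<rfloor>) - t / T * 2 ^ n\<bar> \<le> 1" using nn[of n] by linarith
    then have "\<bar>T / 2 ^ n\<bar> * \<bar>real (nat \<lfloor>t / T * 2 ^ n\<rfloor>) - t / T * 2 ^ n\<bar> \<le> \<bar>T / 2 ^ n\<bar> * 1"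
      by (intro mult_left_mono) auto
    then have "\<bar>T / 2 ^ n * (real (nat \<lfloor>t / T * 2 ^ n\<rfloor>) - t / T * 2 ^ n)\<bar> \<le> T / 2 ^ n"
      unfolding abs_mult using T by simp
    also have "T / 2 ^ n * (real (nat \<lfloor>t / T * 2 ^ n\<rfloor>) - t / T * 2 ^ n) = s n - t"
      using T by (simp add: s_def right_diff_distrib)
    finally show ?thesis by (simp add: power_divide)
  qed
  have "(\<lambda>n. T * (1 / 2) ^ n) \<longlonglongrightarrow> T * 0" by (intro tendsto_intros) auto
  then have "(\<lambda>n. s n - t) \<longlonglongrightarrow> 0"
    by (intro Lim_null_comparison[of "\<lambda>n. s n - t" "\<lambda>n. T * (1 / 2) ^ n"]) (use close in auto)
  then have lim: "s \<longlonglongrightarrow> t" by (simp add: LIM_zero_iff)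
  have sT: "s n \<in> {0..T}" for n
    using T le[of n] by (auto simp: s_def divide_le_eq simp flip: of_nat_le_iff)
  have "(\<lambda>n. x (s n)) \<longlonglongrightarrow> x t"
    using continuous_on_tendsto_compose[OF x lim t] sT by simp
  with C _ show ?thesis
    by (rule closed_sequentially) (use dy[OF le] in \<open>simp add: s_def\<close>)
qed

locale heat_network =
  fixes E :: "'v::finite \<Rightarrow> 'v \<Rightarrow> bool" and D bd :: "'v set" and T :: "'v \<Rightarrow> real" and V U :: "real poly"
    and c\<^sub>0 :: "'v state" and M :: "'w measure" and B :: "'v \<Rightarrow> real \<Rightarrow> 'w \<Rightarrow> real"
    and Z :: "'v state \<Rightarrow> real \<Rightarrow> 'w \<Rightarrow> 'v state"
  assumes convex: "convex_on UNIV (poly V)" "convex_on UNIV (poly U)"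
    and minimizer: "is_arg_min (hamiltonian E V U) (\<lambda>_. True) z \<longleftrightarrow> z = c\<^sub>0"
    and M: "prob_space M"
    and brownian: "independent_brownian_motions M bd B"
    and solution: "heat_network_solution M (hamiltonian E V U) D bd T B Z"
begin

interpretation prob_space M by (rule M)

definition noise :: "'w \<Rightarrow> real \<Rightarrow> 'v state" where
  "noise w t = (0, \<chi> i. if i \<in> bd then sqrt (2 * T i) * B i t w else 0)"

lemma measurable_solution [measurable]: "0 \<le> t \<Longrightarrow> Z z t \<in> borel_measurable M"
  using solution unfolding heat_network_solution_def by blast

text \<open>The vector integral exists by continuity of the path, and its coordinates are identified
  by uniqueness of integrals. The exceptional null set depends on the starting point
  \<open>z\<close>, but not on the time.\<close>

lemma AE_forced_solution:
  "AE w in M. continuous_on {0..} (\<lambda>t. Z z t w) \<and>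
     (\<forall>t\<ge>0. forced_solution (network_drift E V U D) z (noise w) t (\<lambda>s. Z z s w))"
proof -
  let ?F = "network_drift E V U D"
  have "AE w in M. continuous_on {0..} (\<lambda>t. Z z t w) \<and>
      (\<forall>t\<ge>0. \<forall>i. ((\<lambda>s. mom (Z z s w) i) has_integral (pos (Z z t w) i - pos z i)) {0..t} \<and>
        ((\<lambda>s. - partial_q i (hamiltonian E V U) (Z z s w) - (if i \<in> D then mom (Z z s w) i else 0)) has_integral
           (mom (Z z t w) i - mom z i - (if i \<in> bd then sqrt (2 * T i) * B i t w else 0))) {0..t})"
    using solution unfolding heat_network_solution_def by blast
  then show ?thesis
  proof eventually_elim
    case (elim w)
    define x where "x t = Z z t w" for t
    have xc: "continuous_on {0..} x" using elim by (simp add: x_def[abs_def])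
    have int: "((\<lambda>s. ?F (x s)) has_integral (x t - z - noise w t)) {0..t}" if t: "0 \<le> t" for t
    proof -
      have "continuous_on {0..t} (\<lambda>s. ?F (x s))"
        by (rule continuous_on_compose2[OF locally_Lipschitz_continuous[OF locally_Lipschitz_network_drift, of UNIV]
              continuous_on_subset[OF xc]]) auto
      then obtain I where I: "((\<lambda>s. ?F (x s)) has_integral I) {0..t}"
        using integrable_integral[OF integrable_continuous_real] by blast
      have "pos I i = pos (x t - z - noise w t) i" for i
      proof -
        have "((\<lambda>s. mom (x s) i) has_integral pos I i) {0..t}"
          using has_integral_linear[OF I bounded_linear_compose[OF bounded_linear_vec_nth bounded_linear_fst], of i]
          by (simp add: o_def network_drift_def)
        moreover have "((\<lambda>s. mom (x s) i) has_integral (pos (x t) i - pos z i)) {0..t}"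
          using elim t by (simp add: x_def)
        ultimately have "pos I i = pos (x t) i - pos z i" by (rule has_integral_unique)
        then show ?thesis by (simp add: noise_def)
      qed
      moreover have "mom I i = mom (x t - z - noise w t) i" for i
      proof -
        have "((\<lambda>s. - partial_q i (hamiltonian E V U) (x s) - (if i \<in> D then mom (x s) i else 0)) has_integral mom I i) {0..t}"
          using has_integral_linear[OF I bounded_linear_compose[OF bounded_linear_vec_nth bounded_linear_snd], of i]
          by (simp add: o_def network_drift_def)
        moreover have "((\<lambda>s. - partial_q i (hamiltonian E V U) (x s) - (if i \<in> D then mom (x s) i else 0)) has_integral
            (mom (x t) i - mom z i - (if i \<in> bd then sqrt (2 * T i) * B i t w else 0))) {0..t}"
          using elim t unfolding x_def by blast
        ultimately have "mom I i = mom (x t) i - mom z i - (if i \<in> bd then sqrt (2 * T i) * B i t w else 0)"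
          by (rule has_integral_unique)
        then show ?thesis by (simp add: noise_def)
      qed
      ultimately have "I = x t - z - noise w t" by (simp add: prod_eq_iff vec_eq_iff)
      with I show ?thesis by simp
    qed
    have "forced_solution ?F z (noise w) t x" if "0 \<le> t" for t
      unfolding forced_solution_def using int continuous_on_subset[OF xc, of "{0..t}"] by auto
    with xc show ?case by (simp add: x_def[abs_def])
  qed
qed

text \<open>Solutions from different points are driven by the same noise, so convergence of starting
  points gives almost sure convergence of the states at time \<open>t\<close>; Fatou's lemma yields
  lower semicontinuity on open sets.\<close>

lemma feller_kernels_transition: "feller_kernels (transition M Z)"
proof (rule feller_kernels.intro)
  fix t :: real and z assume t: "0 \<le> t"
  show "prob_space (transition M Z t z)" using t
    unfolding transition_def by (intro prob_space_distr) measurable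
next
  fix t :: real and z show "sets (transition M Z t z) = sets borel" by (simp add: transition_def)
next
  fix t :: real and O' :: "'v state set" and \<zeta> :: "nat \<Rightarrow> 'v state" and z assume t: "0 \<le> t" and O': "open O'" and \<zeta>: "\<zeta> \<longlonglongrightarrow> z"
  have [measurable]: "O' \<in> sets borel" using O' by simp
  have eq: "emeasure (transition M Z t y) O' = (\<integral>\<^sup>+w. indicator O' (Z y t w) \<partial>M)" for y
  proof -
    have "emeasure (transition M Z t y) O' = (\<integral>\<^sup>+v. indicator O' v \<partial>distr M borel (Z y t))"
      by (simp add: transition_def)
    also have "\<dots> = (\<integral>\<^sup>+w. indicator O' (Z y t w) \<partial>M)"
      using t by (intro nn_integral_distr) auto
    finally show ?thesis .
  qed
  \<comment> \<open>Null sets depend on the starting point; testing continuity along a sequence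
    keeps their union countable.\<close>
  have "AE w in M. \<forall>k. forced_solution (network_drift E V U D) (\<zeta> k) (noise w) t (\<lambda>s. Z (\<zeta> k) s w)"
    unfolding AE_all_countable
  proof
    fix k show "AE w in M. forced_solution (network_drift E V U D) (\<zeta> k) (noise w) t (\<lambda>s. Z (\<zeta> k) s w)"
      using AE_forced_solution[of "\<zeta> k"] by eventually_elim (use t in blast)
  qed
  with AE_forced_solution[of z]
  have "AE w in M. (\<lambda>k. Z (\<zeta> k) t w) \<longlonglongrightarrow> Z z t w"
  proof eventually_elim
    case (elim w)
    show ?case
      using elim t by (intro forced_solution_tendsto[OF locally_Lipschitz_network_drift _ t _ \<zeta>, where x = "\<lambda>s. Z z s w" and W = "noise w"]) auto
  qed
  then have "AE w in M. (indicator O' (Z z t w) :: ennreal) \<le> liminf (\<lambda>k. indicator O' (Z (\<zeta> k) t w))"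
  proof eventually_elim
    case (elim w)
    show ?case
    proof (cases "Z z t w \<in> O'")
      case True
      have "eventually (\<lambda>k. Z (\<zeta> k) t w \<in> O') sequentially"
        using elim O' True by (rule topological_tendstoD)
      then show ?thesis
        by (intro Liminf_bounded) (auto elim!: eventually_mono simp: indicator_def)
    qed simp
  qed
  then have "(\<integral>\<^sup>+w. indicator O' (Z z t w) \<partial>M) \<le> (\<integral>\<^sup>+w. liminf (\<lambda>k. indicator O' (Z (\<zeta> k) t w)) \<partial>M)"
    by (rule nn_integral_mono_AE)
  also have "\<dots> \<le> liminf (\<lambda>k. \<integral>\<^sup>+w. indicator O' (Z (\<zeta> k) t w) \<partial>M)"
    using t by (intro nn_integral_liminf) measurable
  finally show "emeasure (transition M Z t z) O' \<le> liminf (\<lambda>k. emeasure (transition M Z t (\<zeta> k)) O')"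
    by (simp add: eq)
qed

text \<open>An event of positive probability meets every almost sure event, so some outcome has
  small noise and a path that stays in \<open>S\<close>. A single outcome is enough, since only a
  deterministic path is extracted.\<close>

lemma small_noise_path:
  assumes S: "closed S" and stay: "\<And>t. 0 \<le> t \<Longrightarrow> emeasure (transition M Z t z) (- S) = 0" and \<epsilon>: "0 < \<epsilon>"
  shows "\<exists>W x. forced_solution (network_drift E V U D) z W (real k) x \<and>
    (\<forall>t\<in>{0..real k}. norm (W t) \<le> \<epsilon>) \<and> (\<forall>t\<in>{0..real k}. x t \<in> S)"
proof -
  \<comment> \<open>Bounds the norm of the noise by the sum of its coordinates; the
    \<open>+ 1\<close> permits division by \<open>K\<close>.\<close>
  define K where "K = (\<Sum>i\<in>UNIV. \<bar>sqrt (2 * T i)\<bar>) + 1"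
  have K: "0 < K" unfolding K_def by (simp add: sum_nonneg add_nonneg_pos)
  define \<beta> where "\<beta> = \<epsilon> / K"
  have \<beta>: "0 < \<beta>" using K \<epsilon> by (simp add: \<beta>_def)
  \<comment> \<open>A positive time horizon is required also for \<open>k = 0\<close>.\<close>
  define \<tau> where "\<tau> = real (Suc k)"
  have \<tau>: "0 < \<tau>" "real k \<le> \<tau>" by (auto simp: \<tau>_def)
  define A where "A = {w \<in> space M. \<forall>i\<in>bd. \<forall>n. \<forall>j\<le>2 ^ n. \<bar>B i (\<tau> * real j / 2 ^ n) w\<bar> \<le> \<beta>}"
  have A: "0 < prob A"
    unfolding A_def by (rule independent_brownian_small_ball[OF M brownian _ \<tau>(1) \<beta>]) simp
  have "AE w in M. \<forall>n j. Z z (\<tau> * real j / 2 ^ n) w \<in> S"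
    unfolding AE_all_countable
  proof (intro allI)
    fix n j :: nat
    let ?t = "\<tau> * real j / 2 ^ n"
    have t: "0 \<le> ?t" using \<tau> by simp
    have "- S \<in> null_sets (transition M Z ?t z)"
      using stay[OF t] S by (simp add: null_sets_def transition_def)
    then have "AE y in transition M Z ?t z. y \<notin> - S" by (rule AE_not_in)
    then have "AE y in distr M borel (Z z ?t). y \<in> S" unfolding transition_def Compl_iff not_not .
    then show "AE w in M. Z z ?t w \<in> S"
      using t S by (subst (asm) AE_distr_iff) auto
  qed
  moreover have "AE w in M. \<forall>i\<in>bd. continuous_on {0..} (\<lambda>t. B i t w)"
    using brownian by (intro AE_finite_allI) (auto simp: independent_brownian_motions_def brownian_motion_def)
  moreover note AE_forced_solution[of z]
  ultimately have ae: "AE w in M. (\<forall>n j. Z z (\<tau> * real j / 2 ^ n) w \<in> S) \<and> (\<forall>i\<in>bd. continuous_on {0..} (\<lambda>t. B i t w)) \<and>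
      continuous_on {0..} (\<lambda>t. Z z t w) \<and> (\<forall>t\<ge>0. forced_solution (network_drift E V U D) z (noise w) t (\<lambda>s. Z z s w))"
    by eventually_elim blast
  obtain w where w: "w \<in> A" "\<And>n j. Z z (\<tau> * real j / 2 ^ n) w \<in> S" "\<And>i. i \<in> bd \<Longrightarrow> continuous_on {0..} (\<lambda>t. B i t w)"
    "continuous_on {0..} (\<lambda>t. Z z t w)" "\<And>t. 0 \<le> t \<Longrightarrow> forced_solution (network_drift E V U D) z (noise w) t (\<lambda>s. Z z s w)"
  proof (rule ccontr)
    assume obt: "\<not> thesis"
    have "AE w in M. w \<notin> A"
      using ae
    proof eventually_elim
      case (elim w)
      show ?case using that[of w] elim obt by blast
    qed
    moreover have "A \<in> sets M" using A measure_notin_sets by fastforce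
    ultimately have "A \<in> null_sets M" by (simp add: AE_iff_null_sets)
    then show False using A by (simp add: measure_eq_0_null_sets)
  qed
  show ?thesis
  proof (intro exI conjI ballI)
    show "forced_solution (network_drift E V U D) z (noise w) (real k) (\<lambda>s. Z z s w)" using w(5) by simp
    fix t assume "t \<in> {0..real k}"
    then have t: "t \<in> {0..\<tau>}" using \<tau>(2) by auto
    show "Z z t w \<in> S"
      by (rule closed_path_dyadic[OF continuous_on_subset[OF w(4)] S \<tau>(1) _ t]) (use w(2) in auto)
    have B: "\<bar>B i t w\<bar> \<le> \<beta>" if i: "i \<in> bd" for i
    proof -
      have "B i t w \<in> {- \<beta>..\<beta>}"
        by (rule closed_path_dyadic[OF continuous_on_subset[OF w(3)[OF i]] _ \<tau>(1) _ t])
          (use w(1) i in \<open>auto simp: A_def abs_le_iff minus_le_iff\<close>)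
      then show ?thesis by auto
    qed
    have "norm (noise w t) = norm (\<chi> i. if i \<in> bd then sqrt (2 * T i) * B i t w else 0)"
      by (simp add: noise_def norm_Pair)
    also have "\<dots> \<le> (\<Sum>i\<in>UNIV. \<bar>if i \<in> bd then sqrt (2 * T i) * B i t w else 0\<bar>)"
      by (rule order_trans[OF norm_le_l1_cart]) simp
    also have "\<dots> \<le> (\<Sum>i\<in>UNIV. \<bar>sqrt (2 * T i)\<bar> * \<beta>)"
      using B \<beta> by (intro sum_mono) (auto simp: abs_mult intro!: mult_left_mono)
    also have "\<dots> \<le> K * \<beta>" using \<beta> by (simp add: K_def sum_distrib_right distrib_right)
    also have "\<dots> = \<epsilon>" using K by (simp add: \<beta>_def)
    finally show "norm (noise w t) \<le> \<epsilon>" .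
  qed
qed

lemma hamiltonian_minimum:
  assumes "y \<noteq> c\<^sub>0" shows "hamiltonian E V U c\<^sub>0 < hamiltonian E V U y"
proof -
  obtain y' where "hamiltonian E V U y' < hamiltonian E V U y"
    using minimizer[of y] assms unfolding is_arg_min_def by blast
  moreover have "\<not> hamiltonian E V U y' < hamiltonian E V U c\<^sub>0"
    using minimizer[of c\<^sub>0] unfolding is_arg_min_def by blast
  ultimately show ?thesis by linarith
qed

text \<open>The support of an invariant measure is preserved by the diffusion, hence by the damped
  deterministic flow, which is the limit of paths with vanishing noise. Started at a point of the support
  where \<open>H\<close> is minimal, the flow cannot dissipate energy, so by the stability condition this point is
  the equilibrium.\<close>

lemma equilibrium_in_support:
  assumes stab: "stability_condition (hamiltonian E V U) D c\<^sub>0"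
    and \<mu>: "invariant_measure (transition M Z) \<mu>" and ne: "emeasure \<mu> UNIV \<noteq> 0"
  shows "c\<^sub>0 \<in> measure_support \<mu>"
proof -
  interpret feller_kernels "transition M Z" by (rule feller_kernels_transition)
  let ?H = "hamiltonian E V U" and ?F = "network_drift E V U D" and ?S = "measure_support \<mu>"
  have s: "sets \<mu> = sets borel" using \<mu> by (simp add: invariant_measure_def)
  have S: "closed ?S" using s by (rule closed_measure_support)
  have coercive: "\<exists>R. \<forall>y. ?H y < h \<longrightarrow> norm y < R" for h
    by (rule convex_unique_minimum_coercive[OF convex_on_hamiltonian[OF convex] continuous_on_hamiltonian hamiltonian_minimum])
  have "?S \<noteq> {}" using emeasure_Compl_support[OF s] ne by auto
  then obtain s0 where s0: "s0 \<in> ?S" by blast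
  \<comment> \<open>Intersecting with a sublevel set gives compactness without losing the minimum
    over the support.\<close>
  define C where "C = ?S \<inter> {y. ?H y \<le> ?H s0}"
  have "closed {y. ?H y \<le> ?H s0}" by (intro closed_Collect_le continuous_on_hamiltonian continuous_on_const)
  then have "closed C" unfolding C_def by (intro closed_Int S)
  moreover have "bounded C"
  proof -
    obtain R where R: "\<And>y. ?H y < ?H s0 + 1 \<Longrightarrow> norm y < R" using coercive by blast
    have "norm y \<le> R" if "y \<in> C" for y using R[of y] that by (simp add: C_def)
    then show ?thesis unfolding bounded_iff by blast
  qed
  ultimately have "compact C" by (simp add: compact_eq_bounded_closed)
  moreover have "C \<noteq> {}" using s0 by (auto simp: C_def)
  ultimately have "\<exists>z\<in>C. \<forall>y\<in>C. ?H z \<le> ?H y"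
    using continuous_on_hamiltonian by (rule continuous_attains_inf)
  then obtain z where z: "z \<in> C" "\<And>y. y \<in> C \<Longrightarrow> ?H z \<le> ?H y" by auto
  have zS: "z \<in> ?S" using z(1) by (simp add: C_def)
  have min: "?H z \<le> ?H y" if "y \<in> ?S" for y
    using z that by (cases "?H y \<le> ?H s0") (auto simp: C_def)
  have stay: "emeasure (transition M Z t z) (- ?S) = 0" if "0 \<le> t" for t
    using kernel_stays_in_support[OF \<mu> that zS] .
  obtain R where R: "\<And>y. ?H y < ?H z + 1 \<Longrightarrow> norm y < R" using coercive by blast
  have dissip: "grad_hamiltonian E V U y \<bullet> ?F y \<le> 0" for y
    by (simp add: grad_hamiltonian_inner_drift sum_nonneg)
  \<comment> \<open>The admissible noise size for confinement to the ball of radius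
    \<open>R + 1\<close> depends on the horizon \<open>k\<close>, while the radius does not.\<close>
  define bounding where "bounding k \<eta> \<longleftrightarrow> (\<forall>W x. forced_solution ?F z W (real k) x \<longrightarrow>
      (\<forall>s\<in>{0..real k}. norm (W s) \<le> \<eta>) \<longrightarrow> (\<forall>t\<in>{0..real k}. norm (x t) \<le> R + 1))" for k \<eta>
  have "\<exists>\<eta>>0. bounding k \<eta>" for k
    unfolding bounding_def
    by (rule forced_solution_bounded[OF locally_Lipschitz_network_drift has_derivative_hamiltonian
        continuous_on_grad_hamiltonian dissip _ order_refl]) (rule R)
  then obtain \<eta> where \<eta>: "\<And>k. 0 < \<eta> k" "\<And>k. bounding k (\<eta> k)" by metis
  \<comment> \<open>Small enough for confinement up to time \<open>k\<close>, and tending to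
    0.\<close>
  define \<delta> where "\<delta> k = min (\<eta> k) (1 / real (Suc k))" for k
  have \<delta>: "0 < \<delta> k" for k using \<eta>(1) by (simp add: \<delta>_def)
  define path where "path k W x \<longleftrightarrow> forced_solution ?F z W (real k) x \<and>
      (\<forall>t\<in>{0..real k}. norm (W t) \<le> \<delta> k) \<and> (\<forall>t\<in>{0..real k}. x t \<in> ?S)" for k W x
  have "\<exists>W x. path k W x" for k
    unfolding path_def by (rule small_noise_path[OF S stay \<delta>])
  then obtain W x where "\<And>k. path k (W k) (x k)" by metis
  then have Wx: "\<And>k. forced_solution ?F z (W k) (real k) (x k)"
    "\<And>k t. t \<in> {0..real k} \<Longrightarrow> norm (W k t) \<le> \<delta> k" "\<And>k t. t \<in> {0..real k} \<Longrightarrow> x k t \<in> ?S"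
    unfolding path_def by blast+
  have \<delta>0: "\<delta> \<longlonglongrightarrow> 0"
  proof (rule tendsto_sandwich[OF _ _ tendsto_const])
    show "(\<lambda>k. 1 / real (Suc k)) \<longlonglongrightarrow> 0" using LIMSEQ_inverse_real_of_nat by (simp add: inverse_eq_divide)
  qed (use \<delta> in \<open>auto simp: \<delta>_def intro!: always_eventually less_imp_le\<close>)
  have xR: "norm (x k t) \<le> R + 1" if "t \<in> {0..real k}" for k t
  proof -
    have "\<forall>s\<in>{0..real k}. norm (W k s) \<le> \<eta> k" using Wx(2) by (force simp: \<delta>_def)
    then show ?thesis using \<eta>(2)[of k] Wx(1)[of k] that unfolding bounding_def by blast
  qed
  obtain \<phi> where \<phi>: "\<And>t. 0 \<le> t \<Longrightarrow> (\<lambda>k. x k t) \<longlonglongrightarrow> \<phi> t" "\<phi> 0 = z"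
    "\<And>t. 0 \<le> t \<Longrightarrow> (\<phi> has_vector_derivative ?F (\<phi> t)) (at t within {0..})"
  proof (rule forced_solution_limit[OF locally_Lipschitz_network_drift Wx(1) _ \<delta>0])
    show "norm (W k t) \<le> \<delta> k" if "t \<in> {0..real k}" for k t using that by (rule Wx(2))
    show "norm (x k t) \<le> R + 1" if "t \<in> {0..real k}" for k t using that by (rule xR)
  qed (rule that)
  have \<phi>S: "\<phi> t \<in> ?S" if t: "0 \<le> t" for t
  proof (rule Lim_in_closed_set[OF S _ _ \<phi>(1)[OF t]])
    show "\<forall>\<^sub>F k in sequentially. x k t \<in> ?S"
      using filterlim_real_sequentially[unfolded filterlim_at_top, rule_format, of t]
      by eventually_elim (use Wx(3) t in auto)
  qed simp
  \<comment> \<open>The limit path starts at the point of least energy in the support and never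
    leaves the support, so it cannot dissipate.\<close>
  have "mom (\<phi> t) i = 0" if t: "0 \<le> t" and i: "i \<in> D" for t i
  proof -
    have "grad_hamiltonian E V U (\<phi> t) \<bullet> ?F (\<phi> t) = 0"
      by (rule trajectory_energy_constant[OF has_derivative_hamiltonian dissip \<phi>(3) _ t])
        (use min \<phi>S \<phi>(2) in auto)
    then have "(\<Sum>i\<in>D. (mom (\<phi> t) i)\<^sup>2) = 0" by (simp only: grad_hamiltonian_inner_drift neg_equal_0_iff_equal)
    then have "\<forall>i\<in>D. (mom (\<phi> t) i)\<^sup>2 = 0" by (subst (asm) sum_nonneg_eq_0_iff) auto
    then show ?thesis using i by simp
  qed
  from stability_conditionD[OF stab \<phi>(3) this] have "z = c\<^sub>0" using \<phi>(2) by simp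
  then show ?thesis using zS by simp
qed

lemma unique_invariant_probability:
  assumes asf: "asymptotically_strong_Feller_at (transition M Z) c\<^sub>0"
    and stab: "stability_condition (hamiltonian E V U) D c\<^sub>0"
    and \<mu>: "invariant_probability (transition M Z) \<mu>" and \<nu>: "invariant_probability (transition M Z) \<nu>"
  shows "\<mu> = \<nu>"
proof (rule ccontr)
  interpret feller_kernels "transition M Z" by (rule feller_kernels_transition)
  assume ne: "\<mu> \<noteq> \<nu>"
  obtain \<mu>' \<nu>' Y where *: "invariant_measure (transition M Z) \<mu>'" "invariant_measure (transition M Z) \<nu>'"
    "Y \<in> sets borel" "emeasure \<mu>' (- Y) = 0" "emeasure \<nu>' Y = 0" "emeasure \<mu>' UNIV \<noteq> 0" "emeasure \<nu>' UNIV \<noteq> 0"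
    by (rule distinct_invariant_probabilities_singular[OF \<mu> \<nu> ne])
  show False
    by (rule asymptotically_strong_Feller_not_singular[OF feller_kernels_transition asf *(1-5)
          equilibrium_in_support[OF stab *(1,6)] equilibrium_in_support[OF stab *(2,7)]])
qed

end

theorem mainTheorem4:
  fixes E :: "'v::finite \<Rightarrow> 'v \<Rightarrow> bool"
    and D bd :: "'v set"
    and T :: "'v \<Rightarrow> real"
    and V U :: "real poly"
    and H :: "'v state \<Rightarrow> real"
    and c\<^sub>0 :: "'v state"
    and M :: "'w measure"
    and B :: "'v \<Rightarrow> real \<Rightarrow> 'w \<Rightarrow> real"
    and Z :: "'v state \<Rightarrow> real \<Rightarrow> 'w \<Rightarrow> 'v state"
  assumes "connected_graph E"
    and "D \<noteq> {}" and "bd \<noteq> {}" and "bd \<subseteq> D"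
    and "\<And>i. i \<in> bd \<Longrightarrow> 0 < T i"
    and "convex_on UNIV (poly V)" and "convex_on UNIV (poly U)"
    and "H = hamiltonian E V U"
    and "\<And>z. is_arg_min H (\<lambda>_. True) z \<longleftrightarrow> z = c\<^sub>0"
    and "H c\<^sub>0 = 0"
    and "prob_space M"
    and "independent_brownian_motions M bd B"
    and "heat_network_solution M H D bd T B Z"
    and "asymptotically_strong_Feller_at (transition M Z) c\<^sub>0"
    and "stability_condition H D c\<^sub>0"
    and "invariant_probability (transition M Z) \<mu>"
    and "invariant_probability (transition M Z) \<nu>"
  shows "\<mu> = \<nu>"
proof -
  interpret heat_network E D bd T V U c\<^sub>0 M B Z
    by (rule heat_network.intro[OF assms(6,7) assms(9)[unfolded assms(8)] assms(11,12) assms(13)[unfolded assms(8)]])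
  show ?thesis
    by (rule unique_invariant_probability[OF assms(14) assms(15)[unfolded assms(8)] assms(16,17)])
qed

end
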